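(* Let $(Q,h)$ be a labelled quotient graph (a finite multigraph $Q$ whose edges are directed and labelled by elements of $\mathbb{Z}^3$). Then there are only finitely many linear isotopy classes of linear graph knots in the flat torus $\mathbb{T}^3=[0,1)^3$ which have labelled quotient graph $(Q,h)$.
   Context: The flat 3-torus $\mathbb{T}^3$ is identified with $[0,1)^3$, with the topology and flat structure coming from the quotient map $q:\mathbb{R}^3\to\mathbb{R}^3/\mathbb{Z}^3=[0,1)^3$. A line segment in the flat torus is the image under $q$ of a nondegenerate line segment in $\mathbb{R}^3$. A linear graph knot $K$ in the flat torus is a faithful placement of a finite multigraph $H$ (loops and multiple edges allowed): vertices $v$ are represented by distinct points (nodes) $p(v)\in[0,1)^3$ and each edge $e$ with endpoints $v,w$ is represented by a flat torus line segment $\tilde p(e)$ from $p(v)$ to $p(w)$, where these segments are essentially disjoint: each segment has no self-intersections and distinct segments do not intersect, except possibly at endpoints (nodes). One writes $K=(N,S)$ with $N$ the set of nodes and $S$ the set of segments, and $|K|$ (the body) for the union of the segments in $S$. Labelled quotient graph of a linear graph knot: an edge from $p(v)$ to $p(w)$ lifts to a segment in $\mathbb{R}^3$ of the form $[p(v)+k,\,p(w)+l]$ with $k,l\in\mathbb{Z}^3$ (and $p(v),p(w)\in[0,1)^3$); the corresponding edge of the underlying multigraph, directed from $v$ to $w$, is labelled by $k-l\in\mathbb{Z}^3$. The labelled directed edge $(vw,m)$ is regarded as identical with $(wv,-m)$. Linear graph knots $K_0=(N_0,S_0)$ and $K_1=(N_1,S_1)$ on $\mathbb{T}^3$ are linearly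 isotopic if there are linear graph knots $K_t=(N_t,S_t)$, $0<t<1$, and bijective continuous functions $f_t:|K_0|\to|K_t|$, $0\le t\le 1$, such that $f_0$ is the identity map, $f_t(N_0)=N_t$, $f_t(S_0)=S_t$ (edges map onto edges), and for every $p\in|K_0|$ the path $t\mapsto f_t(p)$, $0\le t\le1$, is continuous. *)

theory Defs
  imports "HOL-Analysis.Analysis" "Graph_Theory.Digraph"
begin

section \<open>The flat torus\<close>

definition torus :: "(real^3) set" where
  "torus = {x. \<forall>i. 0 \<le> x $ i \<and> x $ i < 1}"

definition torus_proj :: "real^3 \<Rightarrow> real^3" where
  "torus_proj x = (\<chi> i. frac (x $ i))"

definition torus_topology :: "(real^3) topology" where
  "torus_topology = topology (\<lambda>U. U \<subseteq> torus \<and> open (torus_proj -` U))"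

lemma openin_torus_topology:
  "openin torus_topology U \<longleftrightarrow> U \<subseteq> torus \<and> open (torus_proj -` U)"
proof -
  have "istopology (\<lambda>U. U \<subseteq> torus \<and> open (torus_proj -` U))"
    unfolding istopology_def by (auto simp: vimage_Int vimage_Union)
  then show ?thesis
    by (simp add: torus_topology_def topology_inverse')
qed

lemma torus_proj_in_torus: "torus_proj x \<in> torus"
  by (simp add: torus_def torus_proj_def frac_ge_0 frac_lt_1)

lemma torus_proj_torus: "x \<in> torus \<Longrightarrow> torus_proj x = x"
  by (simp add: torus_def torus_proj_def vec_eq_iff frac_eq)

lemma torus_proj_image: "range torus_proj = torus"
  using torus_proj_in_torus torus_proj_torus by (metis image_subset_iff rangeI subsetI subset_antisym)

lemma topspace_torus_topology: "topspace torus_topology = torus"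
  unfolding topspace_def openin_torus_topology
  using torus_proj_in_torus by (auto intro!: exI[of _ torus] simp: vimage_def)

lemma quotient_map_torus_proj: "quotient_map euclidean torus_topology torus_proj"
  unfolding quotient_map_def topspace_torus_topology openin_torus_topology
  using torus_proj_image by (auto simp: vimage_def)

section \<open>Flat segments\<close>

definition int_vec :: "int^3 \<Rightarrow> real^3" where
  "int_vec k = (\<chi> i. of_int (k $ i))"

text \<open>The two ends of the image of a segment may coincide (this is a loop edge), but it has
  no other self-intersection. In particular a segment winding several times around a closed
  line is excluded.\<close>

definition simple_segment :: "real^3 \<Rightarrow> real^3 \<Rightarrow> bool" where
  "simple_segment a b \<longleftrightarrow> a \<noteq> b \<and>
     (\<forall>u\<in>closed_segment a b. \<forall>v\<in>closed_segment a b.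
        torus_proj u = torus_proj v \<longrightarrow> u = v \<or> {u, v} = {a, b})"

text \<open>The set \<open>s\<close> is a torus line segment without self-intersections, and \<open>[x + k, y + l]\<close>
  is a lift of it to space.\<close>

definition edge_lift :: "(real^3) set \<Rightarrow> real^3 \<Rightarrow> int^3 \<Rightarrow> real^3 \<Rightarrow> int^3 \<Rightarrow> bool" where
  "edge_lift s x k y l \<longleftrightarrow>
     simple_segment (x + int_vec k) (y + int_vec l) \<and>
     s = torus_proj ` closed_segment (x + int_vec k) (y + int_vec l)"

text \<open>Hence the labelled directed edges \<open>(vw, m)\<close> and \<open>(wv, - m)\<close> are represented by the
  same torus segments.\<close>

lemma edge_lift_reverse: "edge_lift s x k y l \<longleftrightarrow> edge_lift s y l x k"
  unfolding edge_lift_def simple_segment_def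
  by (auto simp: closed_segment_commute insert_commute)

section \<open>Linear graph knots\<close>

text \<open>A multigraph is given by a finite multi-digraph, whose arc directions only matter for the
  labels. A linear graph knot is recorded as the pair of its set of nodes and its set of segments;
  these point sets determine the incidences.\<close>

type_synonym graph_knot = "(real^3) set \<times> (real^3) set set"

definition nodes :: "graph_knot \<Rightarrow> (real^3) set" where
  "nodes K = fst K"

definition segments :: "graph_knot \<Rightarrow> (real^3) set set" where
  "segments K = snd K"

definition body :: "graph_knot \<Rightarrow> (real^3) set" where
  "body K = \<Union>(segments K)"

text \<open>The fourth condition forbids nodes in the interior of a segment. It follows from the last
  condition except for nodes of degree zero.\<close>

definition faithful_placement ::
    "('v, 'e) pre_digraph \<Rightarrow> ('v \<Rightarrow> real^3) \<Rightarrow> ('e \<Rightarrow> (real^3) set) \<Rightarrow> bool" where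
  "faithful_placement H p s \<longleftrightarrow>
     inj_on p (verts H) \<and>
     p ` verts H \<subseteq> torus \<and>
     (\<forall>e\<in>arcs H. \<exists>k l. edge_lift (s e) (p (tail H e)) k (p (head H e)) l) \<and>
     (\<forall>e\<in>arcs H. \<forall>v\<in>verts H. p v \<in> s e \<longrightarrow> v \<in> {tail H e, head H e}) \<and>
     (\<forall>e\<in>arcs H. \<forall>f\<in>arcs H. e \<noteq> f \<longrightarrow>
        s e \<inter> s f \<subseteq> p ` ({tail H e, head H e} \<inter> {tail H f, head H f}))"

text \<open>Any finite multigraph with a faithful placement can be renamed so that its vertices are the
  nodes and its edges are the segments (distinct edges have distinct segments), so fixing the types
  of the vertices and edges of \<open>H\<close> is no restriction.\<close>

definition linear_graph_knot :: "graph_knot \<Rightarrow> bool" where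
  "linear_graph_knot K \<longleftrightarrow>
     (\<exists>(H :: (real^3, (real^3) set) pre_digraph) p s.
        fin_digraph H \<and> faithful_placement H p s \<and>
        nodes K = p ` verts H \<and> segments K = s ` arcs H)"

definition has_labelled_quotient_graph ::
    "graph_knot \<Rightarrow> ('v, 'e) pre_digraph \<Rightarrow> ('e \<Rightarrow> int^3) \<Rightarrow> bool" where
  "has_labelled_quotient_graph K Q h \<longleftrightarrow>
     (\<exists>p s. faithful_placement Q p s \<and>
        nodes K = p ` verts Q \<and> segments K = s ` arcs Q \<and>
        (\<forall>e\<in>arcs Q. \<exists>k l. edge_lift (s e) (p (tail Q e)) k (p (head Q e)) l \<and> h e = k - l))"

section \<open>Linear isotopy\<close>

text \<open>Nodes of degree zero do not belong to the body, but have to be moved along by the isotopy.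
  Therefore the maps are defined on the union of the body and the nodes, which is just the body
  if every node has an incident edge.\<close>

definition linearly_isotopic :: "graph_knot \<Rightarrow> graph_knot \<Rightarrow> bool" where
  "linearly_isotopic K0 K1 \<longleftrightarrow>
     (\<exists>(K :: real \<Rightarrow> graph_knot) (f :: real \<Rightarrow> real^3 \<Rightarrow> real^3).
        K 0 = K0 \<and> K 1 = K1 \<and>
        (\<forall>t\<in>{0..1}.
           linear_graph_knot (K t) \<and>
           bij_betw (f t) (body K0 \<union> nodes K0) (body (K t) \<union> nodes (K t)) \<and>
           continuous_map (subtopology torus_topology (body K0 \<union> nodes K0))
             (subtopology torus_topology (body (K t) \<union> nodes (K t))) (f t) \<and>
           f t ` nodes K0 = nodes (K t) \<and>
           (\<lambda>e. f t ` e) ` segments K0 = segments (K t)) \<and>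
        (\<forall>x\<in>body K0 \<union> nodes K0. f 0 x = x) \<and>
        (\<forall>x\<in>body K0 \<union> nodes K0.
           continuous_map (top_of_set {0..1}) torus_topology (\<lambda>t. f t x)))"

definition linear_isotopy :: "(graph_knot \<times> graph_knot) set" where
  "linear_isotopy = {(K0, K1). linearly_isotopic K0 K1}"

end

theory Submission
  imports Defs
begin

text \<open>A linear graph knot with labelled quotient graph \<open>(Q, h)\<close> is given by the positions of its nodes,
  because the labels then determine a lift of every edge to space. So a knot is a point of the
  configuration space of all maps from \<open>verts Q \<times> {1, 2, 3}\<close> to the reals; the nodes may be any points
  of space, since the configuration is projected to the torus afterwards. Call a configuration
  embedded if it is faithful, that is, if the natural map from the abstract graph to the torus is
  injective. Along a path of embedded configurations these maps fit together to a linear isotopy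
  (\<open>embedded_path_isotopic\<close>), and linear isotopies can be composed (\<open>linearly_isotopic_trans\<close>). Hence
  it suffices that the embedded configurations with all nodes in the unit cube lie in finitely many
  path components of the set of embedded configurations
  (\<open>finitely_many_embedded_components\<close>).

  Up to translation, only finitely many pairs of lifted nodes and edges can meet as long as all
  coordinates are below \<open>2\<close> in absolute value, and whether such a pair meets depends on the signs of
  finitely many polynomials in the coordinates (\<open>meets_sign_determined\<close>). Let \<open>g\<close> be the product of those among
  these polynomials, and among the polynomials \<open>x z \<plusminus> 2\<close>, that do not vanish identically. Along a path
  on which \<open>g\<close> does not vanish no sign changes, so such a path cannot leave the set of embedded
  configurations. An embedded configuration with \<open>g = 0\<close> can first be moved a little along a line,
  because it stays embedded (\<open>eventually_embedded\<close>), to a place where \<open>g \<noteq> 0\<close>.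

  What remains is that the complement of the zero set of a real polynomial has finitely many path
  components (\<open>finitely_many_components_polyfun_nonzero\<close>). The proof is by induction on the number of
  variables, in the manner of cylindrical decomposition. As a polynomial in the last variable, \<open>g\<close> has
  a squarefree part whose real roots are simple and whose degree is constant, away from the zero set of
  a nonzero polynomial \<open>D\<close> in the other variables (\<open>generic_squarefree_part\<close>). Over a path in the region
  \<open>D \<noteq> 0\<close> a non-root can be carried along between the roots (\<open>fibre_transport\<close>), so every point is
  connected to one over one of finitely many base points, and the fibre there minus its roots has
  finitely many pieces. Since only regions of full dimension are needed, the points with \<open>D = 0\<close> can be
  left by a small move.\<close>

section \<open>Polynomial functions of finitely many coordinates\<close>

text \<open>The number of variables changes during the induction below. Therefore all polynomial functions
  live on the same space of families of reals, and \<open>I\<close> is the set of coordinates that may occur.\<close>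

inductive_set polyfun :: "'i set \<Rightarrow> (('i \<Rightarrow> real) \<Rightarrow> real) set" for I :: "'i set" where
  const: "(\<lambda>_. c) \<in> polyfun I"
| var: "i \<in> I \<Longrightarrow> (\<lambda>x. x i) \<in> polyfun I"
| add: "f \<in> polyfun I \<Longrightarrow> g \<in> polyfun I \<Longrightarrow> (\<lambda>x. f x + g x) \<in> polyfun I"
| mult: "f \<in> polyfun I \<Longrightarrow> g \<in> polyfun I \<Longrightarrow> (\<lambda>x. f x * g x) \<in> polyfun I"

lemma polyfun_minus: "f \<in> polyfun I \<Longrightarrow> (\<lambda>x. - f x) \<in> polyfun I"
  using polyfun.mult[OF polyfun.const[of "-1"], of f] by simp

lemma polyfun_diff: "f \<in> polyfun I \<Longrightarrow> g \<in> polyfun I \<Longrightarrow> (\<lambda>x. f x - g x) \<in> polyfun I"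
  using polyfun.add[OF _ polyfun_minus, of f I g] by simp

lemma polyfun_sum: "(\<And>k. k \<in> A \<Longrightarrow> f k \<in> polyfun I) \<Longrightarrow> (\<lambda>x. \<Sum>k\<in>A. f k x) \<in> polyfun I"
  by (induction A rule: infinite_finite_induct) (auto intro: polyfun.intros)

lemma polyfun_prod: "(\<And>k. k \<in> A \<Longrightarrow> f k \<in> polyfun I) \<Longrightarrow> (\<lambda>x. \<Prod>k\<in>A. f k x) \<in> polyfun I"
  by (induction A rule: infinite_finite_induct) (auto intro: polyfun.intros)

lemma polyfun_cong: "f \<in> polyfun I \<Longrightarrow> (\<And>i. i \<in> I \<Longrightarrow> x i = y i) \<Longrightarrow> f x = f y"
  by (induction rule: polyfun.induct) auto

lemma polyfun_continuous: "f \<in> polyfun I \<Longrightarrow> continuous_on S f"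
proof (induction rule: polyfun.induct)
  case (const c)
  show ?case by (rule continuous_on_const)
next
  case (var i)
  show ?case
    by (rule continuous_on_subset[OF continuous_on_product_coordinates]) simp
next
  case (add f g)
  then show ?case by (intro continuous_on_add)
next
  case (mult f g)
  then show ?case by (intro continuous_on_mult)
qed

definition line :: "('i \<Rightarrow> real) \<Rightarrow> ('i \<Rightarrow> real) \<Rightarrow> real \<Rightarrow> 'i \<Rightarrow> real" where
  "line x y t = (\<lambda>i. x i + t * (y i - x i))"

lemma line_0 [simp]: "line x y 0 = x" and line_1 [simp]: "line x y 1 = y"
  by (auto simp: line_def)

lemma continuous_on_line: "continuous_on S (line x y)"
  unfolding line_def by (intro continuous_intros)

lemma polyfun_line:
  assumes "f \<in> polyfun I"
  shows "\<exists>p. \<forall>t. f (line x y t) = poly p t"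
  using assms
proof (induction rule: polyfun.induct)
  case (const c)
  show ?case by (rule exI[of _ "[:c:]"]) simp
next
  case (var i)
  show ?case by (rule exI[of _ "[:x i, y i - x i:]"]) (simp add: line_def)
next
  case (add f g)
  then show ?case by (metis poly_add)
next
  case (mult f g)
  then show ?case by (metis poly_mult)
qed

text \<open>On a line a polynomial function is a polynomial in one variable. This replaces the algebra and the
  topology of polynomials in many variables: it yields that a product of nonzero polynomials is nonzero
  and that nonzero polynomials do not vanish on open sets.\<close>

lemma polyfun_line_zeros:
  assumes "f \<in> polyfun I" "f x \<noteq> 0 \<or> f y \<noteq> 0"
  shows "finite {t. f (line x y t) = 0}"
proof -
  obtain p where p: "\<And>t. f (line x y t) = poly p t"
    using polyfun_line[OF assms(1)] by blast
  have "p \<noteq> 0" using assms(2) p[of 0] p[of 1] by auto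
  then show ?thesis by (simp add: p poly_roots_finite)
qed

lemma polyfun_mult_nonzero:
  assumes "f \<in> polyfun I" "g \<in> polyfun I" "\<exists>x. f x \<noteq> 0" "\<exists>x. g x \<noteq> 0"
  shows "\<exists>x. f x * g x \<noteq> 0"
proof -
  obtain x y where "f x \<noteq> 0" "g y \<noteq> 0" using assms by blast
  then have "finite ({t. f (line x y t) = 0} \<union> {t. g (line x y t) = 0})"
    using polyfun_line_zeros[OF assms(1), of x y] polyfun_line_zeros[OF assms(2), of x y] by simp
  then obtain t where "t \<notin> {t. f (line x y t) = 0} \<union> {t. g (line x y t) = 0}"
    using ex_new_if_finite[OF infinite_UNIV_char_0] by blast
  then show ?thesis by auto
qed

lemma polyfun_prod_nonzero:
  assumes "finite A" "\<And>k. k \<in> A \<Longrightarrow> f k \<in> polyfun I" "\<And>k. k \<in> A \<Longrightarrow> \<exists>x. f k x \<noteq> 0"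
  shows "\<exists>x. (\<Prod>k\<in>A. f k x) \<noteq> 0"
  using assms
proof (induction A rule: finite_induct)
  case (insert a A)
  have "\<exists>x. f a x * (\<Prod>k\<in>A. f k x) \<noteq> 0"
    by (rule polyfun_mult_nonzero) (use insert in \<open>auto intro!: polyfun_prod\<close>)
  then show ?case using insert by simp
qed simp

section \<open>Polynomials in one variable with polynomial coefficients\<close>

text \<open>This is the polynomial ring in one variable over the ring \<open>polyfun I\<close>. An element is stored as the
  family of its specialisations at the points of the base, so that the theory of real polynomials
  applies to each specialisation.\<close>

definition polyfam :: "'i set \<Rightarrow> (('i \<Rightarrow> real) \<Rightarrow> real poly) set" where
  "polyfam I = {F. (\<forall>k. (\<lambda>x. coeff (F x) k) \<in> polyfun I) \<and> (\<exists>n. \<forall>x. \<forall>k\<ge>n. coeff (F x) k = 0)}"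

lemma polyfam_coeff: "F \<in> polyfam I \<Longrightarrow> (\<lambda>x. coeff (F x) k) \<in> polyfun I"
  by (simp add: polyfam_def)

lemma polyfam_const: "f \<in> polyfun I \<Longrightarrow> (\<lambda>x. [:f x:]) \<in> polyfam I"
proof -
  assume f: "f \<in> polyfun I"
  have "(\<lambda>x. coeff [:f x:] k) \<in> polyfun I" for k
    by (cases k) (auto intro: f polyfun.const)
  moreover have "\<forall>x. \<forall>k\<ge>1. coeff [:f x:] k = 0"
    by (metis One_nat_def coeff_pCons_Suc Suc_le_D coeff_0)
  ultimately show ?thesis unfolding polyfam_def by blast
qed

lemma polyfam_const_poly: "(\<lambda>_. p) \<in> polyfam I"
  unfolding polyfam_def
  by (auto intro!: polyfun.const exI[of _ "Suc (degree p)"] coeff_eq_0)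

lemma polyfam_add:
  assumes "F \<in> polyfam I" "G \<in> polyfam I"
  shows "(\<lambda>x. F x + G x) \<in> polyfam I"
proof -
  obtain m n where "\<forall>x. \<forall>k\<ge>m. coeff (F x) k = 0" "\<forall>x. \<forall>k\<ge>n. coeff (G x) k = 0"
    using assms by (auto simp: polyfam_def)
  then have "\<forall>x. \<forall>k\<ge>m + n. coeff (F x + G x) k = 0" by simp
  then show ?thesis using assms unfolding polyfam_def
    by (auto intro!: polyfun.add)
qed

lemma polyfam_mult:
  assumes "F \<in> polyfam I" "G \<in> polyfam I"
  shows "(\<lambda>x. F x * G x) \<in> polyfam I"
proof -
  obtain m n where mn: "\<forall>x. \<forall>k\<ge>m. coeff (F x) k = 0" "\<forall>x. \<forall>k\<ge>n. coeff (G x) k = 0"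
    using assms by (auto simp: polyfam_def)
  have "coeff (F x * G x) k = 0" if "k \<ge> m + n" for x k
    unfolding coeff_mult
  proof (rule sum.neutral, rule ballI)
    fix i assume "i \<in> {..k}"
    then have "i \<ge> m \<or> k - i \<ge> n" using that by auto
    then show "coeff (F x) i * coeff (G x) (k - i) = 0" using mn by auto
  qed
  then have "\<exists>N. \<forall>x. \<forall>k\<ge>N. coeff (F x * G x) k = 0" by blast
  moreover have "(\<lambda>x. coeff (F x * G x) k) \<in> polyfun I" for k
    unfolding coeff_mult using assms by (intro polyfun_sum polyfun.mult polyfam_coeff)
  ultimately show ?thesis unfolding polyfam_def by blast
qed

lemma polyfam_smult: "f \<in> polyfun I \<Longrightarrow> F \<in> polyfam I \<Longrightarrow> (\<lambda>x. smult (f x) (F x)) \<in> polyfam I"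
  using polyfam_mult[OF polyfam_const, of f I F] by simp

lemma polyfam_diff: "F \<in> polyfam I \<Longrightarrow> G \<in> polyfam I \<Longrightarrow> (\<lambda>x. F x - G x) \<in> polyfam I"
  using polyfam_add[of F I "\<lambda>x. smult (-1) (G x)"] polyfam_smult[OF polyfun.const[of "-1"], of G I]
  by simp

lemma polyfam_pderiv:
  assumes "F \<in> polyfam I" shows "(\<lambda>x. pderiv (F x)) \<in> polyfam I"
proof -
  obtain m where m: "\<forall>x. \<forall>k\<ge>m. coeff (F x) k = 0"
    using assms by (auto simp: polyfam_def)
  then have "\<forall>x. \<forall>k\<ge>m. coeff (pderiv (F x)) k = 0"
    by (simp add: coeff_pderiv)
  moreover have "(\<lambda>x. coeff (pderiv (F x)) k) \<in> polyfun I" for k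
    unfolding coeff_pderiv using assms by (intro polyfun.mult polyfun.const polyfam_coeff)
  ultimately show ?thesis unfolding polyfam_def by blast
qed

lemma polyfun_insert_polyfam:
  assumes "f \<in> polyfun (insert a I)"
  shows "\<exists>F\<in>polyfam I. \<forall>x. f x = poly (F x) (x a)"
  using assms
proof (induction rule: polyfun.induct)
  case (const c)
  show ?case by (rule bexI[OF _ polyfam_const_poly[of "[:c:]"]]) simp
next
  case (var i)
  show ?case
  proof (cases "i = a")
    case True
    then show ?thesis by (intro bexI[OF _ polyfam_const_poly[of "[:0,1:]"]]) simp
  next
    case False
    then have "i \<in> I" using var by simp
    then show ?thesis by (intro bexI[OF _ polyfam_const[OF polyfun.var[of i]]]) auto
  qed
next
  case (add f g)
  then obtain F G where "F \<in> polyfam I" "G \<in> polyfam I" "\<forall>x. f x = poly (F x) (x a)" "\<forall>x. g x = poly (G x) (x a)"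
    by blast
  then show ?case by (intro bexI[OF _ polyfam_add[of F I G]]) auto
next
  case (mult f g)
  then obtain F G where "F \<in> polyfam I" "G \<in> polyfam I" "\<forall>x. f x = poly (F x) (x a)" "\<forall>x. g x = poly (G x) (x a)"
    by blast
  then show ?case by (intro bexI[OF _ polyfam_mult[of F I G]]) auto
qed

definition generic_degree :: "(('i \<Rightarrow> real) \<Rightarrow> real poly) \<Rightarrow> nat \<Rightarrow> bool" where
  "generic_degree F d \<longleftrightarrow> (\<forall>x. \<forall>k>d. coeff (F x) k = 0) \<and> (\<exists>x. coeff (F x) d \<noteq> 0)"

lemma generic_degree_exists:
  assumes "\<forall>x. \<forall>k\<ge>n. coeff (F x) k = 0" "\<exists>x. F x \<noteq> 0"
  shows "\<exists>d<n. generic_degree F d"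
proof -
  define N where "N = (LEAST N. \<forall>x. \<forall>k\<ge>N. coeff (F x) k = 0)"
  have N: "\<forall>x. \<forall>k\<ge>N. coeff (F x) k = 0"
    unfolding N_def by (rule LeastI[where P = "\<lambda>N. \<forall>x. \<forall>k\<ge>N. coeff (F x) k = 0", OF assms(1)])
  have "N \<le> n" unfolding N_def using assms(1) by (rule Least_le)
  have "N \<noteq> 0" using N assms(2) by (metis le0 leading_coeff_0_iff)
  then obtain d where d: "N = Suc d" using not0_implies_Suc by blast
  have "\<exists>x. coeff (F x) d \<noteq> 0"
  proof (rule ccontr)
    assume "\<nexists>x. coeff (F x) d \<noteq> 0"
    then have "\<forall>x. \<forall>k\<ge>d. coeff (F x) k = 0"
      using N d by (metis Suc_leI le_neq_implies_less)
    then have "N \<le> d" unfolding N_def by (rule Least_le)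
    then show False using d by simp
  qed
  then show ?thesis using N d \<open>N \<le> n\<close> unfolding generic_degree_def
    by (intro exI[of _ d]) auto
qed

text \<open>Division without fractions: as long as the degree of \<open>F\<close> is at least \<open>e\<close>, multiplying \<open>F\<close> by the
  leading coefficient of \<open>W\<close> allows to cancel its top coefficient. So the factor \<open>c\<close> is a power of that
  leading coefficient.\<close>

lemma polyfam_pseudo_division:
  assumes W: "W \<in> polyfam I" "generic_degree W e"
    and F: "F \<in> polyfam I"
  shows "\<exists>c\<in>polyfun I. \<exists>Q\<in>polyfam I. \<exists>R\<in>polyfam I. (\<exists>x. c x \<noteq> 0) \<and>
           (\<forall>x. smult (c x) (F x) = Q x * W x + R x) \<and> (\<forall>x. \<forall>k\<ge>e. coeff (R x) k = 0)"
proof -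
  have "\<exists>c\<in>polyfun I. \<exists>Q\<in>polyfam I. \<exists>R\<in>polyfam I. (\<exists>x. c x \<noteq> 0) \<and>
           (\<forall>x. smult (c x) (F x) = Q x * W x + R x) \<and> (\<forall>x. \<forall>k\<ge>e. coeff (R x) k = 0)"
    if "F \<in> polyfam I" "\<forall>x. \<forall>k\<ge>n. coeff (F x) k = 0" for F n
    using that
  proof (induction n arbitrary: F)
    case 0
    then show ?case
      by (intro bexI[OF _ polyfun.const[of 1]] bexI[OF _ polyfam_const_poly[of 0]] bexI[OF _ 0(1)]) auto
  next
    case (Suc n)
    show ?case
    proof (cases "n < e")
      case True
      then show ?thesis using Suc.prems
        by (intro bexI[OF _ polyfun.const[of 1]] bexI[OF _ polyfam_const_poly[of 0]]
            bexI[OF _ Suc.prems(1)]) auto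
    next
      case False
      define l where "l x = coeff (W x) e" for x
      define M where "M x = smult (coeff (F x) n) (monom 1 (n - e))" for x
      define F1 where "F1 x = smult (l x) (F x) - M x * W x" for x
      have l: "l \<in> polyfun I" "\<exists>x. l x \<noteq> 0"
        using W unfolding l_def by (auto simp: generic_degree_def intro: polyfam_coeff)
      have M: "M \<in> polyfam I" unfolding M_def
        using Suc.prems by (intro polyfam_smult polyfam_coeff polyfam_const_poly)
      have F1: "F1 \<in> polyfam I" unfolding F1_def
        by (rule polyfam_diff[OF polyfam_smult[OF l(1) Suc.prems(1)] polyfam_mult[OF M W(1)]])
      have MW: "coeff (M x * W x) k = (if k < n - e then 0 else coeff (F x) n * coeff (W x) (k - (n - e)))" for x k
        by (simp add: M_def coeff_monom_mult)
      have "coeff (F1 x) k = 0" if "k \<ge> n" for x k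
      proof (cases "k = n")
        case True
        then show ?thesis using False by (simp add: F1_def MW l_def)
      next
        case neq: False
        then have "coeff (F x) k = 0" "coeff (W x) (k - (n - e)) = 0"
          using that Suc.prems W False by (auto simp: generic_degree_def)
        then show ?thesis by (simp add: F1_def MW)
      qed
      then obtain c Q R where c: "c \<in> polyfun I" "Q \<in> polyfam I" "R \<in> polyfam I" "\<exists>x. c x \<noteq> 0"
        and eq: "\<And>x. smult (c x) (F1 x) = Q x * W x + R x" and R: "\<forall>x. \<forall>k\<ge>e. coeff (R x) k = 0"
        using Suc.IH[OF F1] by blast
      have "smult (c x * l x) (F x) = (Q x + smult (c x) (M x)) * W x + R x" for x
        using eq[of x] unfolding F1_def by (simp add: smult_diff_right algebra_simps)
      moreover have "(\<lambda>x. c x * l x) \<in> polyfun I"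
        by (rule polyfun.mult[OF c(1) l(1)])
      moreover have "\<exists>x. c x * l x \<noteq> 0"
        by (rule polyfun_mult_nonzero[OF c(1) l(1) c(4) l(2)])
      moreover have "(\<lambda>x. Q x + smult (c x) (M x)) \<in> polyfam I"
        by (rule polyfam_add[OF c(2) polyfam_smult[OF c(1) M]])
      ultimately show ?thesis using c(3) R
        by (intro bexI[of _ "\<lambda>x. c x * l x"] bexI[of _ "\<lambda>x. Q x + smult (c x) (M x)"] bexI[of _ R]) auto
    qed
  qed
  moreover obtain n where "\<forall>x. \<forall>k\<ge>n. coeff (F x) k = 0"
    using F unfolding polyfam_def by blast
  ultimately show ?thesis using F by blast
qed

text \<open>At the base point \<open>x\<close>, the polynomial \<open>G x\<close> has the same real roots as \<open>F x\<close>, all of them simple, and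
  the degree \<open>d\<close>.\<close>

definition simple_root_model ::
    "(('i \<Rightarrow> real) \<Rightarrow> real poly) \<Rightarrow> (('i \<Rightarrow> real) \<Rightarrow> real poly) \<Rightarrow> nat \<Rightarrow> ('i \<Rightarrow> real) \<Rightarrow> bool" where
  "simple_root_model F G d x \<longleftrightarrow>
     F x \<noteq> 0 \<and> coeff (G x) d \<noteq> 0 \<and> (\<forall>k>d. coeff (G x) k = 0) \<and>
     (\<forall>t. poly (G x) t = 0 \<longleftrightarrow> poly (F x) t = 0) \<and>
     (\<forall>t. poly (G x) t = 0 \<longrightarrow> poly (pderiv (G x)) t \<noteq> 0)"

text \<open>This is the usual quotient of \<open>F\<close> by the greatest common divisor of \<open>F\<close> and its derivative. The
  divisor is found as a nonzero combination \<open>W\<close> of the two that has the least degree: the remainder of a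
  pseudo-division by \<open>W\<close> is again such a combination of smaller degree, hence zero. Thus \<open>W\<close> divides both
  \<open>F\<close> and the derivative up to a factor that depends only on the base point, and \<open>D\<close> collects these
  factors and the leading coefficients.\<close>

lemma generic_squarefree_part:
  assumes F: "F \<in> polyfam I" and nz: "\<exists>x. F x \<noteq> 0"
  shows "\<exists>G\<in>polyfam I. \<exists>D\<in>polyfun I. \<exists>d.
    (\<exists>x. D x \<noteq> 0) \<and> (\<forall>x. D x \<noteq> 0 \<longrightarrow> simple_root_model F G d x)"
proof -
  obtain n where n: "\<forall>x. \<forall>k\<ge>n. coeff (F x) k = 0" using F by (auto simp: polyfam_def)
  obtain m where m: "generic_degree F m" using generic_degree_exists[OF n nz] by blast
  define comb where "comb U V x = U x * F x + V x * pderiv (F x)" for U V x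
  define P where "P e \<longleftrightarrow> (\<exists>U\<in>polyfam I. \<exists>V\<in>polyfam I. generic_degree (comb U V) e)" for e
  have "comb (\<lambda>_. 1) (\<lambda>_. 0) = F" by (auto simp: comb_def)
  then have "P m" unfolding P_def using m
    by (intro bexI[OF _ polyfam_const_poly[of 1]] bexI[OF _ polyfam_const_poly[of 0]]) simp
  define e where "e = (LEAST e. P e)"
  have Pe: "P e" unfolding e_def using \<open>P m\<close> by (rule LeastI)
  then obtain U V where UV: "U \<in> polyfam I" "V \<in> polyfam I" and W': "generic_degree (comb U V) e"
    unfolding P_def by blast
  define W where "W = comb U V"
  note pd = polyfam_pderiv[OF F]
  have W: "W \<in> polyfam I" "generic_degree W e"
    using W' UV F pd unfolding W_def comb_def by (auto intro!: polyfam_add polyfam_mult)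
  have multiple: "\<exists>c\<in>polyfun I. \<exists>Q\<in>polyfam I. (\<exists>x. c x \<noteq> 0) \<and> (\<forall>x. smult (c x) (comb A B x) = Q x * W x)"
    if AB: "A \<in> polyfam I" "B \<in> polyfam I" for A B
  proof -
    have H: "comb A B \<in> polyfam I"
      using AB F pd unfolding comb_def by (auto intro!: polyfam_add polyfam_mult)
    obtain c Q R where c: "c \<in> polyfun I" "Q \<in> polyfam I" "R \<in> polyfam I" "\<exists>x. c x \<noteq> 0"
      and eq: "\<And>x. smult (c x) (comb A B x) = Q x * W x + R x"
      and R: "\<forall>x. \<forall>k\<ge>e. coeff (R x) k = 0"
      using polyfam_pseudo_division[OF W H] by blast
    have Rc: "R = comb (\<lambda>x. smult (c x) (A x) - Q x * U x) (\<lambda>x. smult (c x) (B x) - Q x * V x)"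
    proof
      fix x
      have "R x = smult (c x) (comb A B x) - Q x * W x" using eq[of x] by simp
      then show "R x = comb (\<lambda>x. smult (c x) (A x) - Q x * U x) (\<lambda>x. smult (c x) (B x) - Q x * V x) x"
        by (simp add: comb_def W_def algebra_simps smult_add_right)
    qed
    have "R x = 0" for x
    proof (rule ccontr)
      assume "R x \<noteq> 0"
      then obtain d where d: "d < e" "generic_degree R d" using generic_degree_exists[OF R] by blast
      have "P d" unfolding P_def
      proof (intro bexI)
        show "generic_degree (comb (\<lambda>x. smult (c x) (A x) - Q x * U x) (\<lambda>x. smult (c x) (B x) - Q x * V x)) d"
          using d(2) by (simp only: Rc)
      qed (rule polyfam_diff[OF polyfam_smult[OF c(1) AB(2)] polyfam_mult[OF c(2) UV(2)]],
          rule polyfam_diff[OF polyfam_smult[OF c(1) AB(1)] polyfam_mult[OF c(2) UV(1)]])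
      then have "e \<le> d" unfolding e_def by (rule Least_le)
      then show False using d(1) by simp
    qed
    then show ?thesis using c eq by auto
  qed
  have "comb (\<lambda>_. 0) (\<lambda>_. 1) = (\<lambda>x. pderiv (F x))" by (auto simp: comb_def)
  with multiple[OF polyfam_const_poly[of 0] polyfam_const_poly[of 1]]
  obtain c2 Q2 where c2: "c2 \<in> polyfun I" "\<exists>x. c2 x \<noteq> 0"
    and eq2: "\<And>x. smult (c2 x) (pderiv (F x)) = Q2 x * W x" by auto
  from multiple[OF polyfam_const_poly[of 1] polyfam_const_poly[of 0]] \<open>comb (\<lambda>_. 1) (\<lambda>_. 0) = F\<close>
  obtain c1 Q where c1: "c1 \<in> polyfun I" "\<exists>x. c1 x \<noteq> 0" and Q: "Q \<in> polyfam I"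
    and eq1: "\<And>x. smult (c1 x) (F x) = Q x * W x" by auto
  have Fm: "(\<lambda>x. coeff (F x) m) \<in> polyfun I" "\<exists>x. coeff (F x) m \<noteq> 0"
    using m polyfam_coeff[OF F] by (auto simp: generic_degree_def)
  have We: "(\<lambda>x. coeff (W x) e) \<in> polyfun I" "\<exists>x. coeff (W x) e \<noteq> 0"
    using W polyfam_coeff[OF W(1)] by (auto simp: generic_degree_def)
  obtain x where "c1 x * coeff (F x) m \<noteq> 0"
    using polyfun_mult_nonzero[OF c1(1) Fm(1) c1(2) Fm(2)] by blast
  then have "c1 x \<noteq> 0" "F x \<noteq> 0" by auto
  then have "Q x \<noteq> 0" using eq1[of x] by auto
  moreover obtain l where "\<forall>x. \<forall>k\<ge>l. coeff (Q x) k = 0" using Q by (auto simp: polyfam_def)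
  ultimately obtain d where d: "generic_degree Q d" using generic_degree_exists by blast
  then have Qd: "(\<lambda>x. coeff (Q x) d) \<in> polyfun I" "\<exists>x. coeff (Q x) d \<noteq> 0"
    using Q polyfam_coeff[OF Q] by (auto simp: generic_degree_def)
  define D where "D x = (c1 x * c2 x) * (coeff (W x) e * coeff (Q x) d)" for x
  have D: "D \<in> polyfun I" "\<exists>x. D x \<noteq> 0"
    unfolding D_def
    using polyfun_mult_nonzero[OF polyfun.mult[OF c1(1) c2(1)] polyfun.mult[OF We(1) Qd(1)]
        polyfun_mult_nonzero[OF c1(1) c2(1) c1(2) c2(2)] polyfun_mult_nonzero[OF We(1) Qd(1) We(2) Qd(2)]]
    by (simp_all only: polyfun.mult[OF polyfun.mult[OF c1(1) c2(1)] polyfun.mult[OF We(1) Qd(1)]])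
  have "simple_root_model F Q d x" if "D x \<noteq> 0" for x
  proof -
    have nz: "c1 x \<noteq> 0" "c2 x \<noteq> 0" "coeff (W x) e \<noteq> 0" "coeff (Q x) d \<noteq> 0" using that by (auto simp: D_def)
    then have nz': "W x \<noteq> 0" "Q x \<noteq> 0" by auto
    have F0: "F x \<noteq> 0" using eq1[of x] nz nz' by auto
    have roots: "rsquarefree (Q x) \<and> (\<forall>t. poly (Q x) t = 0 \<longleftrightarrow> poly (F x) t = 0)"
    proof (cases "pderiv (F x) = 0")
      case True
      then have "degree (F x) = 0" by (simp add: pderiv_eq_0_iff)
      then have "degree (Q x * W x) = 0" using eq1[of x] nz by (metis degree_smult_eq)
      then have "degree (Q x) = 0" using nz' by (simp add: degree_mult_eq)
      with \<open>degree (F x) = 0\<close> obtain a b where "F x = [:a:]" "Q x = [:b:]"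
        using degree_eq_zeroE by metis
      then show ?thesis using F0 nz' by (auto simp: rsquarefree_roots)
    next
      case False
      have "F x = smult (inverse (c1 x)) (smult (c1 x) (F x))" using nz by simp
      then have "F x = smult (inverse (c1 x)) (Q x) * W x" unfolding eq1 by simp
      have "pderiv (F x) = smult (inverse (c2 x)) (smult (c2 x) (pderiv (F x)))" using nz by simp
      then have "pderiv (F x) = smult (inverse (c2 x)) (Q2 x) * W x" unfolding eq2 by simp
      have "W x = U x * F x + V x * pderiv (F x)" by (simp add: W_def comb_def)
      have "rsquarefree (smult (inverse (c1 x)) (Q x)) \<and>
          (\<forall>t. poly (smult (inverse (c1 x)) (Q x)) t = 0 \<longleftrightarrow> poly (F x) t = 0)"
        by (rule poly_squarefree_decomp[OF False]) fact+
      then show ?thesis using nz by (auto simp: rsquarefree_roots pderiv_smult)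
    qed
    then show ?thesis using F0 nz d by (auto simp: simple_root_model_def rsquarefree_roots generic_degree_def)
  qed
  then show ?thesis using D Q by blast
qed

section \<open>Transport of non-roots along a path of polynomials\<close>

lemma poly_eq_sum_of_bound:
  fixes p :: "real poly"
  assumes "\<And>k. k > d \<Longrightarrow> coeff p k = 0"
  shows "poly p t = (\<Sum>k\<le>d. coeff p k * t ^ k)"
proof -
  have "degree p \<le> d" using assms by (intro degree_le) auto
  then show ?thesis unfolding poly_altdef
    by (intro sum.mono_neutral_left) (auto simp: coeff_eq_0)
qed

lemma continuous_on_poly_family:
  fixes H :: "real \<Rightarrow> real poly"
  assumes c: "\<And>k. continuous_on S (\<lambda>s. coeff (H s) k)"
    and d: "\<And>s k. s \<in> S \<Longrightarrow> k > d \<Longrightarrow> coeff (H s) k = 0"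
  shows "continuous_on (S \<times> UNIV) (\<lambda>z. poly (H (fst z)) (snd z))"
proof -
  have "continuous_on (S \<times> UNIV) (\<lambda>z. \<Sum>k\<le>d. coeff (H (fst z)) k * snd z ^ k)"
    by (intro continuous_intros continuous_on_compose2[OF c]) auto
  moreover have "(\<Sum>k\<le>d. coeff (H (fst z)) k * snd z ^ k) = poly (H (fst z)) (snd z)"
    if "z \<in> S \<times> UNIV" for z
    using that d by (intro poly_eq_sum_of_bound[symmetric]) auto
  ultimately show ?thesis by (subst continuous_on_cong[OF refl, of _ _ "\<lambda>z. \<Sum>k\<le>d. coeff (H (fst z)) k * snd z ^ k"]) auto
qed

text \<open>The zeros over \<open>K\<close> form a compact set, so their projection to the parameter interval is closed.\<close>

lemma nonvanishing_tube:
  fixes \<phi> :: "real \<times> 'a::metric_space \<Rightarrow> 'b::real_normed_vector"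
  assumes "continuous_on ({0..1} \<times> UNIV) \<phi>" "compact K" "\<And>\<tau>. \<tau> \<in> K \<Longrightarrow> \<phi> (s0, \<tau>) \<noteq> 0"
  shows "\<exists>\<delta>>0. \<forall>s\<in>{0..1}. dist s s0 < \<delta> \<longrightarrow> (\<forall>\<tau>\<in>K. \<phi> (s, \<tau>) \<noteq> 0)"
proof -
  define Z where "Z = ({0..1} \<times> K) \<inter> \<phi> -` {0}"
  have "continuous_on ({0..1} \<times> K) \<phi>"
    using assms(1) by (rule continuous_on_subset) auto
  then have "closed Z" unfolding Z_def
    using assms(2) by (intro continuous_closed_preimage closed_Times compact_imp_closed) auto
  moreover have "compact ({0..1::real} \<times> K)" using assms(2) by (intro compact_Times) auto
  ultimately have "compact Z" unfolding Z_def
    by (metis Int_absorb1 Int_lower1 compact_Int_closed)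
  then have "closed (fst ` Z)"
    by (intro compact_imp_closed compact_continuous_image continuous_on_fst continuous_on_id)
  moreover have "s0 \<in> - fst ` Z" using assms(3) by (auto simp: Z_def)
  ultimately obtain \<delta> where "\<delta> > 0" "ball s0 \<delta> \<subseteq> - fst ` Z"
    by (meson open_Compl open_contains_ball)
  then show ?thesis
    by (intro exI[of _ \<delta>]) (force simp: Z_def dist_commute image_iff subset_iff)
qed

definition fibre_complement :: "(real \<Rightarrow> real poly) \<Rightarrow> (real \<times> real) set" where
  "fibre_complement H = {z. fst z \<in> {0..1} \<and> poly (H (fst z)) (snd z) \<noteq> 0}"

text \<open>Isolate each root of \<open>H s0\<close> in an interval on which the derivative has no zero. For \<open>s\<close> near \<open>s0\<close>,
  compactness and the bound on the roots leave no root of \<open>H s\<close> outside these intervals, and by Rolle's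
  theorem each interval contains at most one. So a non-root inside an interval can be moved to one of the
  two ends of the interval, and a non-root outside can be kept while \<open>s\<close> varies.\<close>

lemma fibre_transport_local:
  fixes H :: "real \<Rightarrow> real poly"
  assumes c: "\<And>k. continuous_on {0..1} (\<lambda>s. coeff (H s) k)"
    and d: "\<And>s k. s \<in> {0..1} \<Longrightarrow> k > d \<Longrightarrow> coeff (H s) k = 0"
    and lead: "\<And>s. s \<in> {0..1} \<Longrightarrow> coeff (H s) d \<noteq> 0"
    and simple: "\<And>s t. s \<in> {0..1} \<Longrightarrow> poly (H s) t = 0 \<Longrightarrow> poly (pderiv (H s)) t \<noteq> 0"
    and s0: "s0 \<in> {0..1}"
  shows "\<exists>\<delta>>0. \<forall>s\<in>{0..1}. \<forall>s'\<in>{0..1}. dist s s0 < \<delta> \<longrightarrow> dist s' s0 < \<delta> \<longrightarrow>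
           (\<forall>\<tau>. poly (H s) \<tau> \<noteq> 0 \<longrightarrow> (\<exists>\<tau>'. path_component (fibre_complement H) (s, \<tau>) (s', \<tau>')))"
proof -
  define Z where "Z = {t. poly (H s0) t = 0}"
  have "H s0 \<noteq> 0" using lead[OF s0] by auto
  then have finZ: "finite Z" unfolding Z_def by (rule poly_roots_finite)
  have contH: "continuous_on ({0..1} \<times> UNIV) (\<lambda>z. poly (H (fst z)) (snd z))"
    by (rule continuous_on_poly_family[OF c d])
  have contD: "continuous_on ({0..1} \<times> UNIV) (\<lambda>z. poly (pderiv (H (fst z))) (snd z))"
  proof (rule continuous_on_poly_family[where d = d])
    show "continuous_on {0..1} (\<lambda>s. coeff (pderiv (H s)) k)" for k
      unfolding coeff_pderiv by (intro continuous_intros c)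
  qed (simp add: coeff_pderiv d)
  have "\<exists>\<epsilon>>0. \<forall>t. \<bar>t - r\<bar> \<le> \<epsilon> \<longrightarrow> poly (pderiv (H s0)) t \<noteq> 0" if "r \<in> Z" for r
  proof -
    have "poly (pderiv (H s0)) r \<noteq> 0" using that simple[OF s0] by (auto simp: Z_def)
    moreover have "open {t. poly (pderiv (H s0)) t \<noteq> 0}"
      by (intro open_Collect_neq continuous_intros)
    ultimately obtain e where "e > 0" "cball r e \<subseteq> {t. poly (pderiv (H s0)) t \<noteq> 0}"
      by (metis (mono_tags, lifting) mem_Collect_eq open_contains_cball)
    then show ?thesis by (intro exI[of _ e]) (auto simp: subset_iff dist_real_def abs_minus_commute)
  qed
  then obtain \<epsilon> where \<epsilon>: "\<And>r. r \<in> Z \<Longrightarrow> \<epsilon> r > 0"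
    "\<And>r t. r \<in> Z \<Longrightarrow> \<bar>t - r\<bar> \<le> \<epsilon> r \<Longrightarrow> poly (pderiv (H s0)) t \<noteq> 0"
    by metis
  \<comment> \<open>Rolle's theorem, by which an interval without zeros of the derivative contains at most one root.\<close>
  have unique: "r1 = r2" if "poly p r1 = 0" "poly p r2 = 0" "r1 \<le> r2"
      "\<And>t. r1 \<le> t \<Longrightarrow> t \<le> r2 \<Longrightarrow> poly (pderiv p) t \<noteq> 0" for p :: "real poly" and r1 r2
  proof (rule ccontr)
    assume "r1 \<noteq> r2"
    then have "r1 < r2" using that(3) by simp
    from poly_MVT[OF this, of p] obtain t where t: "r1 < t" "t < r2"
      "poly p r2 - poly p r1 = (r2 - r1) * poly (pderiv p) t"
      by blast
    then have "poly (pderiv p) t = 0" using \<open>r1 < r2\<close> that(1,2) by simp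
    then show False using t that(4)[of t] by simp
  qed
  have ends: "poly (H s0) t \<noteq> 0" if "r \<in> Z" "\<bar>t - r\<bar> = \<epsilon> r" for r t
  proof
    assume "poly (H s0) t = 0"
    moreover have "poly (H s0) r = 0" using that(1) by (simp add: Z_def)
    moreover have "poly (pderiv (H s0)) u \<noteq> 0" if "min r t \<le> u" "u \<le> max r t" for u
      using that \<open>\<bar>t - r\<bar> = \<epsilon> r\<close> by (intro \<epsilon>(2)[OF \<open>r \<in> Z\<close>]) linarith
    ultimately have "t = r"
      using unique[of "H s0" r t] unique[of "H s0" t r] by (cases "r \<le> t") auto
    then show False using that \<epsilon>(1)[OF that(1)] by simp
  qed
  \<comment> \<open>Substituting \<open>1 / t\<close> for \<open>t\<close> turns the leading coefficient into the value at \<open>0\<close>, so that the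
    roots stay bounded for \<open>s\<close> near \<open>s0\<close>.\<close>
  define \<Phi> where "\<Phi> z = (\<Sum>k\<le>d. coeff (H (fst z)) (d - k) * snd z ^ k)" for z :: "real \<times> real"
  have contP: "continuous_on ({0..1} \<times> UNIV) \<Phi>"
    unfolding \<Phi>_def by (intro continuous_intros continuous_on_compose2[OF c]) auto
  have P_eq: "poly (H s) t = t ^ d * \<Phi> (s, inverse t)" if "s \<in> {0..1}" "t \<noteq> 0" for s t
  proof -
    have "poly (H s) t = (\<Sum>k\<le>d. coeff (H s) k * t ^ k)"
      using that d by (intro poly_eq_sum_of_bound) auto
    also have "\<dots> = (\<Sum>k\<le>d. coeff (H s) (d - k) * t ^ (d - k))"
      by (rule sum.reindex_bij_witness[of _ "\<lambda>k. d - k" "\<lambda>k. d - k"]) auto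
    also have "\<dots> = (\<Sum>k\<le>d. t ^ d * (coeff (H s) (d - k) * inverse t ^ k))"
      by (intro sum.cong refl) (simp add: power_diff that power_inverse field_simps)
    finally show ?thesis by (simp add: \<Phi>_def sum_distrib_left)
  qed
  have "\<Phi> (s0, 0) = coeff (H s0) d"
    unfolding \<Phi>_def by (simp add: power_0_left if_distrib cong: if_cong)
  then have "\<Phi> (s0, 0) \<noteq> 0" using lead[OF s0] by simp
  moreover have "continuous_on UNIV (\<lambda>t. \<Phi> (s0, t))"
    by (rule continuous_on_compose2[OF contP]) (use s0 in \<open>auto intro!: continuous_intros\<close>)
  then have "open {t. \<Phi> (s0, t) \<noteq> 0}"
    by (intro open_Collect_neq continuous_intros)
  ultimately obtain \<eta> where \<eta>: "\<eta> > 0" "cball 0 \<eta> \<subseteq> {t. \<Phi> (s0, t) \<noteq> 0}"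
    by (metis (mono_tags, lifting) mem_Collect_eq open_contains_cball)
  obtain \<delta>1 where \<delta>1: "\<delta>1 > 0"
    "\<And>s t. s \<in> {0..1} \<Longrightarrow> dist s s0 < \<delta>1 \<Longrightarrow> t \<in> cball 0 \<eta> \<Longrightarrow> \<Phi> (s, t) \<noteq> 0"
    using nonvanishing_tube[OF contP compact_cball, of 0 \<eta> s0] \<eta> by blast
  have far: "poly (H s) t \<noteq> 0" if "s \<in> {0..1}" "dist s s0 < \<delta>1" "\<bar>t\<bar> \<ge> inverse \<eta>" for s t
  proof -
    have "\<bar>t\<bar> > 0" using that(3) \<eta>(1) by (meson less_le_trans positive_imp_inverse_positive)
    moreover have "inverse \<bar>t\<bar> \<le> \<eta>"
      using le_imp_inverse_le[OF that(3)] \<eta>(1) by simp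
    ultimately show ?thesis using P_eq[OF that(1), of t] \<delta>1(2)[OF that(1,2), of "inverse t"] by auto
  qed
  define K where "K = cball 0 (inverse \<eta>) \<inter> (\<Inter>r\<in>Z. {t. \<epsilon> r \<le> \<bar>t - r\<bar>})"
  have "compact K" unfolding K_def
    by (intro compact_Int_closed compact_cball closed_INT ballI closed_Collect_le continuous_intros)
  moreover have "poly (H s0) t \<noteq> 0" if "t \<in> K" for t
    using that \<epsilon>(1)[of t] by (auto simp: K_def Z_def)
  ultimately obtain \<delta>2 where \<delta>2: "\<delta>2 > 0"
    "\<And>s t. s \<in> {0..1} \<Longrightarrow> dist s s0 < \<delta>2 \<Longrightarrow> t \<in> K \<Longrightarrow> poly (H s) t \<noteq> 0"
    using nonvanishing_tube[OF contH, of K s0] by auto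
  have away: "poly (H s) t \<noteq> 0" if "s \<in> {0..1}" "dist s s0 < min \<delta>1 \<delta>2" "\<And>r. r \<in> Z \<Longrightarrow> \<epsilon> r \<le> \<bar>t - r\<bar>" for s t
    using that far[of s t] \<delta>2(2)[of s t] by (cases "\<bar>t\<bar> \<ge> inverse \<eta>") (auto simp: K_def)
  have "\<forall>r\<in>Z. \<exists>\<delta>>0. \<forall>s\<in>{0..1}. dist s s0 < \<delta> \<longrightarrow>
      (\<forall>t\<in>cball r (\<epsilon> r). poly (pderiv (H s)) t \<noteq> 0) \<and> (\<forall>t\<in>{r - \<epsilon> r, r + \<epsilon> r}. poly (H s) t \<noteq> 0)"
  proof
    fix r assume r: "r \<in> Z"
    obtain a where a: "a > 0" "\<And>s. s \<in> {0..1} \<Longrightarrow> dist s s0 < a \<Longrightarrow> (\<forall>t\<in>cball r (\<epsilon> r). poly (pderiv (H s)) t \<noteq> 0)"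
      using nonvanishing_tube[OF contD compact_cball, of r "\<epsilon> r" s0] \<epsilon>(2)[OF r]
      by (auto simp: dist_real_def abs_minus_commute)
    obtain b where b: "b > 0" "\<And>s. s \<in> {0..1} \<Longrightarrow> dist s s0 < b \<Longrightarrow> (\<forall>t\<in>{r - \<epsilon> r, r + \<epsilon> r}. poly (H s) t \<noteq> 0)"
    proof (atomize_elim)
      have "compact {r - \<epsilon> r, r + \<epsilon> r}" by (intro finite_imp_compact) simp
      moreover have "poly (H s0) t \<noteq> 0" if "t \<in> {r - \<epsilon> r, r + \<epsilon> r}" for t
        using that \<epsilon>(1)[OF r] by (intro ends[OF r]) auto
      ultimately have "\<exists>b>0. \<forall>s\<in>{0..1}. dist s s0 < b \<longrightarrow> (\<forall>t\<in>{r - \<epsilon> r, r + \<epsilon> r}. poly (H s) t \<noteq> 0)"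
        using nonvanishing_tube[OF contH, of "{r - \<epsilon> r, r + \<epsilon> r}" s0] by simp
      then show "\<exists>b>0. \<forall>s. s \<in> {0..1} \<longrightarrow> dist s s0 < b \<longrightarrow> (\<forall>t\<in>{r - \<epsilon> r, r + \<epsilon> r}. poly (H s) t \<noteq> 0)"
        by blast
    qed
    show "\<exists>\<delta>>0. \<forall>s\<in>{0..1}. dist s s0 < \<delta> \<longrightarrow>
      (\<forall>t\<in>cball r (\<epsilon> r). poly (pderiv (H s)) t \<noteq> 0) \<and> (\<forall>t\<in>{r - \<epsilon> r, r + \<epsilon> r}. poly (H s) t \<noteq> 0)"
      using a b by (intro exI[of _ "min a b"]) auto
  qed
  from bchoice[OF this] obtain \<delta>3 where
    "\<forall>r\<in>Z. \<delta>3 r > 0 \<and> (\<forall>s\<in>{0..1}. dist s s0 < \<delta>3 r \<longrightarrow>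
      (\<forall>t\<in>cball r (\<epsilon> r). poly (pderiv (H s)) t \<noteq> 0) \<and> (\<forall>t\<in>{r - \<epsilon> r, r + \<epsilon> r}. poly (H s) t \<noteq> 0))"
    by (rule exE)
  then have \<delta>3: "\<And>r. r \<in> Z \<Longrightarrow> \<delta>3 r > 0"
    "\<And>r s t. r \<in> Z \<Longrightarrow> s \<in> {0..1} \<Longrightarrow> dist s s0 < \<delta>3 r \<Longrightarrow> t \<in> cball r (\<epsilon> r) \<Longrightarrow> poly (pderiv (H s)) t \<noteq> 0"
    "\<And>r s t. r \<in> Z \<Longrightarrow> s \<in> {0..1} \<Longrightarrow> dist s s0 < \<delta>3 r \<Longrightarrow> t \<in> {r - \<epsilon> r, r + \<epsilon> r} \<Longrightarrow> poly (H s) t \<noteq> 0"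
    by blast+
  define \<delta> where "\<delta> = Min (insert (min \<delta>1 \<delta>2) (\<delta>3 ` Z))"
  have \<delta>: "\<delta> > 0" "\<delta> \<le> min \<delta>1 \<delta>2" "\<And>r. r \<in> Z \<Longrightarrow> \<delta> \<le> \<delta>3 r"
    unfolding \<delta>_def using finZ \<delta>1(1) \<delta>2(1) \<delta>3(1) by (auto intro!: Min_le simp del: min.bounded_iff)
  have horizontal: "path_component (fibre_complement H) (s, t) (s', t)"
    if ss: "s \<in> {0..1}" "s' \<in> {0..1}" "dist s s0 < \<delta>" "dist s' s0 < \<delta>"
      and t: "\<And>u. u \<in> {0..1} \<Longrightarrow> dist u s0 < \<delta> \<Longrightarrow> poly (H u) t \<noteq> 0" for s s' t
  proof (rule path_component_linepath)
    have *: "closed_segment s s' \<subseteq> {0..1} \<inter> ball s0 \<delta>"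
      using ss by (intro closed_segment_subset convex_Int convex_ball) (auto simp: dist_commute)
    have "closed_segment (s, t) (s', t) \<subseteq> closed_segment s s' \<times> {t}"
      by (auto dest: closed_segment_PairD)
    also have "closed_segment s s' \<times> {t} \<subseteq> fibre_complement H"
    proof
      fix z assume z: "z \<in> closed_segment s s' \<times> {t}"
      then have "fst z \<in> {0..1} \<inter> ball s0 \<delta>" using * by auto
      then show "z \<in> fibre_complement H"
        using z t[of "fst z"] by (auto simp: fibre_complement_def dist_commute)
    qed
    finally show "closed_segment (s, t) (s', t) \<subseteq> fibre_complement H" .
  qed
  have "\<exists>\<tau>'. path_component (fibre_complement H) (s, \<tau>) (s', \<tau>')"
    if ss: "s \<in> {0..1}" "s' \<in> {0..1}" "dist s s0 < \<delta>" "dist s' s0 < \<delta>" and \<tau>: "poly (H s) \<tau> \<noteq> 0" for s s' \<tau>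
  proof (cases "\<forall>r\<in>Z. \<epsilon> r \<le> \<bar>\<tau> - r\<bar>")
    case True
    then show ?thesis using \<delta>(2) by (intro exI[of _ \<tau>] horizontal[OF ss] away) auto
  next
    case False
    then obtain r where r: "r \<in> Z" "\<bar>\<tau> - r\<bar> < \<epsilon> r" by auto
    have s: "dist s s0 < \<delta>3 r" using ss(3) \<delta>(3)[OF r(1)] by simp
    have "\<exists>t\<in>{r - \<epsilon> r, r + \<epsilon> r}. \<forall>u\<in>closed_segment \<tau> t. poly (H s) u \<noteq> 0"
    proof (rule ccontr)
      assume "\<not> ?thesis"
      then obtain u1 u2 where u: "u1 \<in> closed_segment \<tau> (r - \<epsilon> r)" "poly (H s) u1 = 0"
        "u2 \<in> closed_segment \<tau> (r + \<epsilon> r)" "poly (H s) u2 = 0" by blast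
      then have le: "r - \<epsilon> r \<le> u1" "u1 \<le> \<tau>" "\<tau> \<le> u2" "u2 \<le> r + \<epsilon> r"
        using r(2) by (auto simp: closed_segment_eq_real_ivl split: if_splits)
      have "u1 = u2"
        by (rule unique[OF u(2,4)], use le in simp, rule \<delta>3(2)[OF r(1) ss(1) s])
          (use le in \<open>auto simp: dist_real_def\<close>)
      then have "u1 = \<tau>" using le by simp
      then show False using u(2) \<tau> by simp
    qed
    then obtain t where t: "t \<in> {r - \<epsilon> r, r + \<epsilon> r}" "\<forall>u\<in>closed_segment \<tau> t. poly (H s) u \<noteq> 0" by blast
    have "closed_segment (s, \<tau>) (s, t) \<subseteq> {s} \<times> closed_segment \<tau> t"
      by (auto dest: closed_segment_PairD)
    also have "{s} \<times> closed_segment \<tau> t \<subseteq> fibre_complement H"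
    proof
      fix z assume "z \<in> {s} \<times> closed_segment \<tau> t"
      then have "fst z = s" "snd z \<in> closed_segment \<tau> t" by auto
      then show "z \<in> fibre_complement H" using t(2) ss(1) by (simp add: fibre_complement_def)
    qed
    finally have "path_component (fibre_complement H) (s, \<tau>) (s, t)"
      by (rule path_component_linepath)
    moreover have "path_component (fibre_complement H) (s, t) (s', t)"
      using \<delta>(3)[OF r(1)] by (intro horizontal[OF ss] \<delta>3(3)[OF r(1)] t(1)) auto
    ultimately show ?thesis using path_component_trans by blast
  qed
  then show ?thesis using \<delta>(1) by blast
qed

lemma fibre_transport:
  fixes H :: "real \<Rightarrow> real poly"
  assumes c: "\<And>k. continuous_on {0..1} (\<lambda>s. coeff (H s) k)"
    and d: "\<And>s k. s \<in> {0..1} \<Longrightarrow> k > d \<Longrightarrow> coeff (H s) k = 0"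
    and lead: "\<And>s. s \<in> {0..1} \<Longrightarrow> coeff (H s) d \<noteq> 0"
    and simple: "\<And>s t. s \<in> {0..1} \<Longrightarrow> poly (H s) t = 0 \<Longrightarrow> poly (pderiv (H s)) t \<noteq> 0"
    and \<tau>: "poly (H 0) \<tau> \<noteq> 0"
  shows "\<exists>\<tau>'. path_component (fibre_complement H) (0, \<tau>) (1, \<tau>')"
proof -
  define R where "R s s' \<longleftrightarrow> (\<forall>\<tau>. poly (H s) \<tau> \<noteq> 0 \<longrightarrow> (\<exists>\<tau>'. path_component (fibre_complement H) (s, \<tau>) (s', \<tau>')))" for s s'
  have end_nz: "poly (H s') \<tau>' \<noteq> 0" if "path_component (fibre_complement H) (s, \<tau>) (s', \<tau>')" for s s' \<tau> \<tau>'
    using path_component_mem(2)[OF that] by (simp add: fibre_complement_def)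
  have R_trans: "R s u" if "R s t" "R t u" for s t u
    unfolding R_def
  proof (intro allI impI)
    fix \<tau> assume "poly (H s) \<tau> \<noteq> 0"
    then obtain \<tau>' where p: "path_component (fibre_complement H) (s, \<tau>) (t, \<tau>')" using \<open>R s t\<close> by (auto simp: R_def)
    then obtain \<tau>'' where "path_component (fibre_complement H) (t, \<tau>') (u, \<tau>'')"
      using \<open>R t u\<close> end_nz[OF p] unfolding R_def by blast
    then show "\<exists>\<tau>'. path_component (fibre_complement H) (s, \<tau>) (u, \<tau>')"
      using p path_component_trans by blast
  qed
  have "R 0 1 \<and> R 1 0"
  proof (rule connected_equivalence_relation[where S = "{0..1::real}" and R = "\<lambda>s s'. R s s' \<and> R s' s"])
    fix a :: real assume a: "a \<in> {0..1}"
    obtain \<delta> where \<delta>: "\<delta> > 0" "\<And>s s'. s \<in> {0..1} \<Longrightarrow> s' \<in> {0..1} \<Longrightarrow> dist s a < \<delta> \<Longrightarrow> dist s' a < \<delta> \<Longrightarrow> R s s'"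
      using fibre_transport_local[OF c d lead simple a] unfolding R_def by blast
    show "\<exists>T. openin (top_of_set {0..1}) T \<and> a \<in> T \<and> (\<forall>x\<in>T. R a x \<and> R x a)"
      using \<delta> a by (intro exI[of _ "{0..1} \<inter> ball a \<delta>"]) (auto simp: openin_open_Int dist_commute)
  qed (use R_trans in auto)
  then show ?thesis using \<tau> by (auto simp: R_def)
qed

text \<open>Non-roots with the same roots on their left lie in the same gap.\<close>

lemma finite_representatives_nonroots:
  fixes p :: "real poly"
  assumes "p \<noteq> 0"
  shows "\<exists>T. finite T \<and> (\<forall>t. poly p t \<noteq> 0 \<longrightarrow> (\<exists>u\<in>T. \<forall>w\<in>closed_segment t u. poly p w \<noteq> 0))"
proof -
  define Z where "Z = {t. poly p t = 0}"
  have "finite Z" unfolding Z_def using assms by (rule poly_roots_finite)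
  define cut where "cut t = {z\<in>Z. z < t}" for t
  define rep where "rep A = (SOME t. poly p t \<noteq> 0 \<and> cut t = A)" for A
  have "\<exists>u\<in>rep ` Pow Z. \<forall>w\<in>closed_segment t u. poly p w \<noteq> 0" if t: "poly p t \<noteq> 0" for t
  proof (intro bexI ballI)
    have rep: "poly p (rep (cut t)) \<noteq> 0 \<and> cut (rep (cut t)) = cut t"
      unfolding rep_def
      by (rule someI[where P = "\<lambda>u. poly p u \<noteq> 0 \<and> cut u = cut t" and x = t]) (simp add: t)
    fix w assume w: "w \<in> closed_segment t (rep (cut t))"
    show "poly p w \<noteq> 0"
    proof
      assume w0: "poly p w = 0"
      have "w \<noteq> t" "w \<noteq> rep (cut t)" using rep t w0 by auto
      then have "w < t \<longleftrightarrow> \<not> w < rep (cut t)"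
        using w by (auto simp: closed_segment_eq_real_ivl split: if_splits)
      moreover have "w < t \<longleftrightarrow> w < rep (cut t)"
        using rep w0 unfolding cut_def Z_def by blast
      ultimately show False by blast
    qed
  qed (auto simp: cut_def)
  then show ?thesis using \<open>finite Z\<close> by (intro exI[of _ "rep ` Pow Z"]) auto
qed

section \<open>The complement of a real hypersurface has finitely many path components\<close>

lemma path_component_image:
  assumes "path_component S x y" "continuous_on S f" "f ` S \<subseteq> T"
  shows "path_component T (f x) (f y)"
proof -
  obtain g where g: "path g" "path_image g \<subseteq> S" "pathstart g = x" "pathfinish g = y"
    using assms(1) by (auto simp: path_component_def)
  have "path (f \<circ> g)" using g assms(2) by (intro path_continuous_image) (auto intro: continuous_on_subset)
  then show ?thesis unfolding path_component_def using g assms(3)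
    by (intro exI[of _ "f \<circ> g"]) (auto simp: path_image_compose pathstart_compose pathfinish_compose)
qed

lemma path_component_line:
  assumes "\<And>t. t \<in> {0..1} \<Longrightarrow> line x y t \<in> S"
  shows "path_component S x y"
  unfolding path_component_def
  by (rule exI[of _ "line x y"])
    (use assms in \<open>auto simp: path_def path_image_def pathstart_def pathfinish_def intro: continuous_on_line\<close>)

lemma path_component_line_small:
  assumes f: "f \<in> polyfun I" and g: "g \<in> polyfun I" and "f x \<noteq> 0" "\<exists>y. g y \<noteq> 0"
  shows "\<exists>y. g y \<noteq> 0 \<and> path_component {x. f x \<noteq> 0} x y"
proof -
  obtain y where y: "g y \<noteq> 0" using assms by blast
  have "open {t. f (line x y t) \<noteq> 0}"
    by (intro open_Collect_neq continuous_on_compose2[OF polyfun_continuous[OF f] continuous_on_line] continuous_intros) auto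
  moreover have "0 \<in> {t. f (line x y t) \<noteq> 0}" using assms by simp
  ultimately obtain e where e: "e > 0" "cball 0 e \<subseteq> {t. f (line x y t) \<noteq> 0}"
    by (metis open_contains_cball)
  have "finite {t. g (line x y t) = 0}" using polyfun_line_zeros[OF g] y by blast
  then have "infinite ({0<..<e} - {t. g (line x y t) = 0})" using e(1) by (simp add: infinite_Ioo)
  then obtain t where "t \<in> {0<..<e} - {t. g (line x y t) = 0}"
    using infinite_imp_nonempty by blast
  then have t: "0 < t" "t < e" "g (line x y t) \<noteq> 0" by auto
  have "line x (line x y t) u = line x y (u * t)" for u by (auto simp: line_def)
  moreover have "f (line x y (u * t)) \<noteq> 0" if "u \<in> {0..1}" for u
  proof -
    have "u * t \<le> 1 * t" using that t by (intro mult_right_mono) auto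
    then have "u * t \<le> e" using t by linarith
    moreover have "0 \<le> u * t" using that t by simp
    ultimately have "u * t \<in> cball 0 e" by (simp only: mem_cball dist_real_def)
    then show ?thesis using e(2) by blast
  qed
  ultimately have "path_component {x. f x \<noteq> 0} x (line x y t)"
    by (intro path_component_line) simp
  then show ?thesis using t(3) by blast
qed

theorem finitely_many_components_polyfun_nonzero:
  assumes "finite I" "f \<in> polyfun I"
  shows "\<exists>S. finite S \<and> (\<forall>x. f x \<noteq> 0 \<longrightarrow> (\<exists>s\<in>S. path_component {x. f x \<noteq> 0} x s))"
  using assms
proof (induction I arbitrary: f rule: finite_induct)
  case empty
  have "path_component {x. f x \<noteq> 0} x (\<lambda>_. 0)" if "f x \<noteq> 0" for x
  proof (rule path_component_line)
    show "line x (\<lambda>_. 0) t \<in> {x. f x \<noteq> 0}" for t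
      using that polyfun_cong[OF empty, of "line x (\<lambda>_. 0) t" x] by simp
  qed
  then show ?case by (intro exI[of _ "{\<lambda>_. 0}"]) simp
next
  case (insert a I)
  show ?case
  proof (cases "\<exists>x. f x \<noteq> 0")
    case False
    then show ?thesis by (intro exI[of _ "{}"]) auto
  next
    case True
    obtain F where F: "F \<in> polyfam I" and fF: "\<And>x. f x = poly (F x) (x a)"
      using polyfun_insert_polyfam[OF insert.prems] by blast
    have "\<exists>x. F x \<noteq> 0" using True fF by (metis poly_0)
    from generic_squarefree_part[OF F this] obtain G D d
      where G: "G \<in> polyfam I" and D: "D \<in> polyfun I" "\<exists>x. D x \<noteq> 0"
        and gen': "\<And>x. D x \<noteq> 0 \<Longrightarrow> simple_root_model F G d x"
      by blast
    have gen: "\<And>x. D x \<noteq> 0 \<Longrightarrow> F x \<noteq> 0" "\<And>x. D x \<noteq> 0 \<Longrightarrow> coeff (G x) d \<noteq> 0"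
      "\<And>x k. D x \<noteq> 0 \<Longrightarrow> k > d \<Longrightarrow> coeff (G x) k = 0"
      "\<And>x t. D x \<noteq> 0 \<Longrightarrow> poly (G x) t = 0 \<longleftrightarrow> poly (F x) t = 0"
      "\<And>x t. D x \<noteq> 0 \<Longrightarrow> poly (G x) t = 0 \<Longrightarrow> poly (pderiv (G x)) t \<noteq> 0"
      using gen' by (simp_all add: simple_root_model_def)
    obtain S where S: "finite S" "\<And>x. D x \<noteq> 0 \<Longrightarrow> \<exists>s\<in>S. path_component {x. D x \<noteq> 0} x s"
      using insert.IH[OF D(1)] by blast
    have "\<exists>T. finite T \<and> (\<forall>t. poly (F s) t \<noteq> 0 \<longrightarrow> (\<exists>u\<in>T. \<forall>w\<in>closed_segment t u. poly (F s) w \<noteq> 0))"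
      if "D s \<noteq> 0" for s
      using finite_representatives_nonroots[OF gen(1)[OF that]] .
    then have "\<forall>s. \<exists>T. D s \<noteq> 0 \<longrightarrow> finite T \<and>
        (\<forall>t. poly (F s) t \<noteq> 0 \<longrightarrow> (\<exists>u\<in>T. \<forall>w\<in>closed_segment t u. poly (F s) w \<noteq> 0))" by blast
    from choice[OF this] obtain T where "\<forall>s. D s \<noteq> 0 \<longrightarrow> finite (T s) \<and>
        (\<forall>t. poly (F s) t \<noteq> 0 \<longrightarrow> (\<exists>u\<in>T s. \<forall>w\<in>closed_segment t u. poly (F s) w \<noteq> 0))"
      by (rule exE)
    then have T: "\<And>s. D s \<noteq> 0 \<Longrightarrow> finite (T s)"
      "\<And>s t. D s \<noteq> 0 \<Longrightarrow> poly (F s) t \<noteq> 0 \<Longrightarrow> \<exists>u\<in>T s. \<forall>w\<in>closed_segment t u. poly (F s) w \<noteq> 0"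
      by simp_all
    have F_upd: "F (x(a := t)) = F x" for x t
    proof (rule poly_eqI)
      show "coeff (F (x(a := t))) k = coeff (F x) k" for k
        using insert.hyps(2) by (intro polyfun_cong[OF polyfam_coeff[OF F]]) auto
    qed
    have f_upd: "f (x(a := t)) = poly (F x) t" for x t
      by (simp add: fF F_upd)
    \<comment> \<open>Base points in every component of \<open>D \<noteq> 0\<close>, with a value in every gap between the roots over them.\<close>
    define S' where "S' = (\<Union>s\<in>{s\<in>S. D s \<noteq> 0}. (\<lambda>t. s(a := t)) ` T s)"
    have "finite S'" unfolding S'_def using S(1) T(1) by auto
    moreover have "\<exists>s\<in>S'. path_component {x. f x \<noteq> 0} x s" if fx: "f x \<noteq> 0" for x
    proof -
      have "D \<in> polyfun (insert a I)" using D(1)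
        by (induction rule: polyfun.induct) (auto intro: polyfun.intros)
      then obtain y where y: "D y \<noteq> 0" "path_component {x. f x \<noteq> 0} x y"
        using path_component_line_small[OF insert.prems _ fx D(2)] by blast
      obtain s where s: "s \<in> S" "path_component {x. D x \<noteq> 0} y s" using S(2)[OF y(1)] by blast
      then obtain \<beta> where \<beta>: "path \<beta>" "path_image \<beta> \<subseteq> {x. D x \<noteq> 0}" "pathstart \<beta> = y" "pathfinish \<beta> = s"
        by (auto simp: path_component_def)
      have D\<beta>: "D (\<beta> u) \<noteq> 0" if "u \<in> {0..1}" for u
      proof -
        have "\<beta> u \<in> path_image \<beta>" using that by (simp add: path_image_def)
        then show ?thesis using \<beta>(2) by blast
      qed
      have cont\<beta>: "continuous_on {0..1} \<beta>" using \<beta>(1) by (simp add: path_def)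
      define H where "H u = G (\<beta> u)" for u
      have "f y \<noteq> 0" using path_component_mem(2)[OF y(2)] by simp
      then have "poly (H 0) (y a) \<noteq> 0"
        using \<beta>(3) gen(4)[OF y(1)] by (simp add: H_def pathstart_def fF)
      then obtain \<tau> where \<tau>: "path_component (fibre_complement H) (0, y a) (1, \<tau>)"
      proof (atomize_elim, intro fibre_transport[of H d])
        show "continuous_on {0..1} (\<lambda>s. coeff (H s) k)" for k
          unfolding H_def
          by (rule continuous_on_compose2[OF polyfun_continuous[OF polyfam_coeff[OF G]] cont\<beta>]) auto
      qed (use gen D\<beta> in \<open>auto simp: H_def\<close>)
      have "path_component {x. f x \<noteq> 0} ((\<lambda>z. (\<beta> (fst z))(a := snd z)) (0, y a)) ((\<lambda>z. (\<beta> (fst z))(a := snd z)) (1, \<tau>))"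
      proof (rule path_component_image[OF \<tau>])
        show "continuous_on (fibre_complement H) (\<lambda>z. (\<beta> (fst z))(a := snd z))"
        proof (rule continuous_on_coordinatewise_then_product)
          fix i
          have "continuous_on (fibre_complement H) (\<lambda>z. \<beta> (fst z) i)"
            by (rule continuous_on_compose2[OF continuous_on_product_then_coordinatewise[OF cont\<beta>, of i]])
              (auto intro!: continuous_intros simp: fibre_complement_def)
          then show "continuous_on (fibre_complement H) (\<lambda>z. ((\<beta> (fst z))(a := snd z)) i)"
            by (cases "i = a") (auto intro!: continuous_intros)
        qed
        show "(\<lambda>z. (\<beta> (fst z))(a := snd z)) ` fibre_complement H \<subseteq> {x. f x \<noteq> 0}"
          using gen(4)[OF D\<beta>] by (auto simp: fibre_complement_def f_upd H_def)
      qed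
      then have ys: "path_component {x. f x \<noteq> 0} y (s(a := \<tau>))"
        using \<beta>(3,4) by (simp add: pathstart_def pathfinish_def)
      have Ds: "D s \<noteq> 0" using path_component_mem(2)[OF s(2)] by simp
      have "poly (F s) \<tau> \<noteq> 0" using path_component_mem(2)[OF ys] by (simp add: f_upd)
      then obtain u where u: "u \<in> T s" "\<And>w. w \<in> closed_segment \<tau> u \<Longrightarrow> poly (F s) w \<noteq> 0"
        using T(2)[OF Ds] by blast
      have "path_component {x. f x \<noteq> 0} (s(a := \<tau>)) (s(a := u))"
      proof (rule path_component_line)
        fix t :: real assume "t \<in> {0..1}"
        then have "\<tau> + t * (u - \<tau>) \<in> closed_segment \<tau> u"
          by (auto simp: closed_segment_def algebra_simps intro!: exI[of _ t])
        moreover have "line (s(a := \<tau>)) (s(a := u)) t = s(a := \<tau> + t * (u - \<tau>))"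
          by (auto simp: line_def)
        ultimately show "line (s(a := \<tau>)) (s(a := u)) t \<in> {x. f x \<noteq> 0}"
          using u(2) by (simp add: f_upd)
      qed
      moreover have "s(a := u) \<in> S'" using s(1) Ds u(1) by (auto simp: S'_def)
      ultimately show ?thesis using y(2) ys path_component_trans by blast
    qed
    ultimately show ?thesis by blast
  qed
qed

section \<open>Segments in the torus and their lifts\<close>

lemma faithful_placement_disjoint:
  assumes "faithful_placement H p s" "e \<in> arcs H" "f \<in> arcs H" "e \<noteq> f"
  shows "s e \<inter> s f \<subseteq> p ` ({tail H e, head H e} \<inter> {tail H f, head H f})"
  using assms unfolding faithful_placement_def by simp

lemma int_vec_0 [simp]: "int_vec 0 = 0"
  and int_vec_add: "int_vec (k + l) = int_vec k + int_vec l"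
  and int_vec_minus: "int_vec (- k) = - int_vec k"
  and int_vec_diff: "int_vec (k - l) = int_vec k - int_vec l"
  and int_vec_eq_iff [simp]: "int_vec k = int_vec l \<longleftrightarrow> k = l"
  by (simp_all add: int_vec_def vec_eq_iff)

lemma torus_proj_add_int_vec [simp]: "torus_proj (u + int_vec m) = torus_proj u"
  by (simp add: torus_proj_def int_vec_def vec_eq_iff frac_def)

lemma torus_proj_eq_iff: "torus_proj u = torus_proj v \<longleftrightarrow> (\<exists>m. u = v + int_vec m)"
proof
  assume eq: "torus_proj u = torus_proj v"
  define m :: "int^3" where "m = (\<chi> i. \<lfloor>u $ i\<rfloor> - \<lfloor>v $ i\<rfloor>)"
  have "u $ i = v $ i + real_of_int (m $ i)" for i
  proof -
    have "frac (u $ i) = frac (v $ i)"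
      using eq by (simp add: torus_proj_def vec_eq_iff)
    then show ?thesis by (simp add: frac_def m_def)
  qed
  then show "\<exists>m. u = v + int_vec m"
    by (intro exI[of _ m]) (simp add: vec_eq_iff int_vec_def)
qed auto

lemma continuous_map_torus_proj: "continuous_map euclidean torus_topology torus_proj"
  by (rule quotient_imp_continuous_map[OF quotient_map_torus_proj])

lemma closed_range_int_vec: "closed (range int_vec)"
proof -
  have "range int_vec = {x. \<forall>i. x $ i \<in> \<int>}"
  proof (intro set_eqI iffI)
    fix x :: "real^3" assume "x \<in> {x. \<forall>i. x $ i \<in> \<int>}"
    then have "x = int_vec (\<chi> i. \<lfloor>x $ i\<rfloor>)"
      by (simp add: int_vec_def vec_eq_iff)
    then show "x \<in> range int_vec" by blast
  qed (auto simp: int_vec_def)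
  moreover have "closed ((\<lambda>x::real^3. x $ i) -` \<int>)" for i
    by (rule closed_vimage[OF closed_Ints]) (intro continuous_intros)
  then have "closed (\<Inter>i. (\<lambda>x::real^3. x $ i) -` \<int>)" by (intro closed_INT) auto
  ultimately show ?thesis by (simp add: vimage_def Collect_all_eq)
qed

text \<open>The preimage of the image is the sum of a compact set and the closed set of integer vectors.\<close>

lemma closedin_torus_proj_compact:
  assumes "compact A" shows "closedin torus_topology (torus_proj ` A)"
proof -
  have "torus_proj -` (torus_proj ` A) = (\<Union>x\<in>A. \<Union>y\<in>range int_vec. {x + y})"
    by (auto simp: torus_proj_eq_iff)
  then have "closed (torus_proj -` (torus_proj ` A))"
    using compact_closed_sums[OF assms closed_range_int_vec] by simp
  moreover have "torus_proj -` (torus - torus_proj ` A) = - (torus_proj -` (torus_proj ` A))"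
    using torus_proj_in_torus by auto
  ultimately show ?thesis
    unfolding closedin_def topspace_torus_topology openin_torus_topology
    using torus_proj_in_torus by auto
qed

text \<open>Stated with the parameters of the points on the segment, simplicity is visibly invariant under
  translations by integer vectors.\<close>

lemma simple_segment_iff:
  "simple_segment a b \<longleftrightarrow> a \<noteq> b \<and>
     (\<forall>u\<in>{0..1}. \<forall>u'\<in>{0..1}. torus_proj ((1 - u) *\<^sub>R a + u *\<^sub>R b) = torus_proj ((1 - u') *\<^sub>R a + u' *\<^sub>R b)
        \<longrightarrow> u = u' \<or> {u, u'} = {0, 1})"
proof (cases "a = b")
  case False
  define A where "A u = (1 - u) *\<^sub>R a + u *\<^sub>R b" for u :: real
  have "inj A"
  proof (rule injI)
    fix u u' assume "A u = A u'"
    then have "(u - u') *\<^sub>R (b - a) = 0" by (simp add: A_def algebra_simps)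
    then show "u = u'" using False by simp
  qed
  have eq: "A u = A u' \<longleftrightarrow> u = u'" for u u' using \<open>inj A\<close> by (simp add: inj_eq)
  have "{A u, A u'} = {a, b} \<longleftrightarrow> A ` {u, u'} = A ` {0, 1}" for u u'
    by (simp add: A_def)
  then have pair: "{A u, A u'} = {a, b} \<longleftrightarrow> {u, u'} = {0, 1}" for u u'
    by (simp only: inj_image_eq_iff[OF \<open>inj A\<close>])
  have seg: "closed_segment a b = A ` {0..1}"
    by (auto simp: closed_segment_def A_def)
  show ?thesis
    unfolding simple_segment_def seg A_def[symmetric] ball_simps using False by (simp add: eq pair)
qed (simp add: simple_segment_def)

lemma simple_segment_translate:
  "simple_segment (a + int_vec k) (b + int_vec k) \<longleftrightarrow> simple_segment a b"
proof -
  have "(1 - u) *\<^sub>R (a + int_vec k) + u *\<^sub>R (b + int_vec k) = ((1 - u) *\<^sub>R a + u *\<^sub>R b) + int_vec k" for u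
    by (simp add: algebra_simps)
  then show ?thesis unfolding simple_segment_iff by simp
qed

lemma torus_proj_closed_segment_translate:
  "torus_proj ` closed_segment (a + int_vec k) (b + int_vec k) = torus_proj ` closed_segment a b"
proof -
  have "closed_segment (a + int_vec k) (b + int_vec k) = (\<lambda>x. x + int_vec k) ` closed_segment a b"
    using closed_segment_translation[of "int_vec k" a b] by (simp add: add.commute)
  then show ?thesis by (simp add: image_image)
qed

lemma edge_lift_iff:
  "edge_lift s x k y l \<longleftrightarrow>
     simple_segment x (y + int_vec (l - k)) \<and> s = torus_proj ` closed_segment x (y + int_vec (l - k))"
proof -
  have "y + int_vec l = (y + int_vec (l - k)) + int_vec k" by (simp add: int_vec_diff)
  then show ?thesis
    unfolding edge_lift_def
    by (simp only: simple_segment_translate torus_proj_closed_segment_translate)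
qed

section \<open>Configurations of a labelled graph\<close>

locale labelled_graph = fin_digraph Q for Q :: "('v, 'e) pre_digraph" +
  fixes h :: "'e \<Rightarrow> int^3"
begin

definition pt :: "('v \<times> 3 \<Rightarrow> real) \<Rightarrow> 'v \<Rightarrow> real^3" where
  "pt x v = (\<chi> i. x (v, i))"

text \<open>Pairs of a vertex and an integer vector are the vertices of the periodic graph that covers the knot.\<close>

definition pos :: "('v \<times> 3 \<Rightarrow> real) \<Rightarrow> 'v \<times> (int^3) \<Rightarrow> real^3" where
  "pos x w = pt x (fst w) + int_vec (snd w)"

text \<open>Nodes and edges are treated alike: a cell is a vertex or an edge, and a vertex counts as an edge
  that is constant. An edge is lifted so that it starts at its tail without an integer shift; the
  label \<open>h e = k - l\<close> of a lift from \<open>tail + k\<close> to \<open>head + l\<close> then forces it to end at \<open>head - h e\<close>.\<close>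

definition src :: "'v + 'e \<Rightarrow> 'v \<times> (int^3)" where
  "src c = (case c of Inl v \<Rightarrow> (v, 0) | Inr e \<Rightarrow> (tail Q e, 0))"

definition tgt :: "'v + 'e \<Rightarrow> 'v \<times> (int^3)" where
  "tgt c = (case c of Inl v \<Rightarrow> (v, 0) | Inr e \<Rightarrow> (head Q e, - h e))"

definition cell_point :: "('v \<times> 3 \<Rightarrow> real) \<Rightarrow> 'v + 'e \<Rightarrow> real \<Rightarrow> real^3" where
  "cell_point x c u = (1 - u) *\<^sub>R pos x (src c) + u *\<^sub>R pos x (tgt c)"

definition cells :: "('v + 'e) set" where
  "cells = Inl ` verts Q \<union> Inr ` arcs Q"

text \<open>The points of the abstract graph: every vertex once, and the interior points of the edges. The
  parameter of a vertex is irrelevant to its position; the value \<open>1/2\<close> has the advantage that all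
  parameters lie strictly between \<open>0\<close> and \<open>1\<close>.\<close>

definition ground :: "(('v + 'e) \<times> real) set" where
  "ground = {(c, u). c \<in> cells \<and> 0 < u \<and> u < 1 \<and> (\<forall>v. c = Inl v \<longrightarrow> u = 1/2)}"

definition place :: "('v \<times> 3 \<Rightarrow> real) \<Rightarrow> ('v + 'e) \<times> real \<Rightarrow> real^3" where
  "place x z = torus_proj (cell_point x (fst z) (snd z))"

definition embedded :: "('v \<times> 3 \<Rightarrow> real) \<Rightarrow> bool" where
  "embedded x \<longleftrightarrow> inj_on (place x) ground"

definition node :: "'v \<Rightarrow> ('v + 'e) \<times> real" where
  "node v = (Inl v, 1/2)"

text \<open>The point of the abstract graph that has the parameter \<open>u\<close> on the closed cell \<open>c\<close>.\<close>

definition ground_point :: "'v + 'e \<Rightarrow> real \<Rightarrow> ('v + 'e) \<times> real" where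
  "ground_point c u = (if u = 0 then node (fst (src c)) else if u = 1 then node (fst (tgt c))
     else case c of Inl v \<Rightarrow> node v | Inr e \<Rightarrow> (Inr e, u))"

definition seg :: "('v \<times> 3 \<Rightarrow> real) \<Rightarrow> 'e \<Rightarrow> (real^3) set" where
  "seg x e = torus_proj ` closed_segment (pos x (src (Inr e))) (pos x (tgt (Inr e)))"

definition knot :: "('v \<times> 3 \<Rightarrow> real) \<Rightarrow> graph_knot" where
  "knot x = ((\<lambda>v. torus_proj (pt x v)) ` verts Q, seg x ` arcs Q)"

lemma src_simps [simp]: "src (Inl v) = (v, 0)" "src (Inr e) = (tail Q e, 0)"
  and tgt_simps [simp]: "tgt (Inl v) = (v, 0)" "tgt (Inr e) = (head Q e, - h e)"
  by (simp_all add: src_def tgt_def)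

lemma finite_cells: "finite cells" by (simp add: cells_def)

lemma cells_iff [simp]: "Inl v \<in> cells \<longleftrightarrow> v \<in> verts Q" "Inr e \<in> cells \<longleftrightarrow> e \<in> arcs Q"
  by (auto simp: cells_def)

lemma ends_in_verts: "c \<in> cells \<Longrightarrow> fst (src c) \<in> verts Q" "c \<in> cells \<Longrightarrow> fst (tgt c) \<in> verts Q"
  by (auto simp: cells_def)

lemma ground_iff [simp]: "node v \<in> ground \<longleftrightarrow> v \<in> verts Q" "(Inr e, u) \<in> ground \<longleftrightarrow> e \<in> arcs Q \<and> 0 < u \<and> u < 1"
  by (auto simp: ground_def node_def)

lemma node_eq [simp]: "node v = node w \<longleftrightarrow> v = w" "node v \<noteq> (Inr e, u)" "(Inr e, u) \<noteq> node v"
  by (auto simp: node_def)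

lemma ground_cases:
  assumes "z \<in> ground"
  obtains v where "z = node v" "v \<in> verts Q" | e u where "z = (Inr e, u)" "e \<in> arcs Q" "0 < u" "u < 1"
  using assms by (cases "fst z"; cases z) (auto simp: ground_def node_def)

lemma cell_point_node: "cell_point x (Inl v) u = pt x v"
  by (simp add: cell_point_def pos_def algebra_simps)

lemma place_node [simp]: "place x (node v) = torus_proj (pt x v)"
  by (simp add: place_def node_def cell_point_node)

lemma torus_proj_pos: "torus_proj (pos x w) = torus_proj (pt x (fst w))"
  by (simp add: pos_def)

lemma place_ground_point: "place x (ground_point c u) = torus_proj (cell_point x c u)"
proof (cases "u = 0 \<or> u = 1")
  case True
  then show ?thesis by (auto simp: ground_point_def cell_point_def torus_proj_pos)
next
  case False
  then show ?thesis by (cases c) (auto simp: ground_point_def cell_point_node, simp add: place_def)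
qed

lemma ground_point_in_ground: "c \<in> cells \<Longrightarrow> u \<in> {0..1} \<Longrightarrow> ground_point c u \<in> ground"
  using ends_in_verts by (cases c) (auto simp: ground_point_def)

lemma seg_eq: "seg x e = place x ` ground_point (Inr e) ` {0..1}"
proof -
  have "closed_segment (pos x (src (Inr e))) (pos x (tgt (Inr e))) = cell_point x (Inr e) ` {0..1}"
    by (auto simp: closed_segment_def cell_point_def)
  then show ?thesis by (simp add: seg_def image_image place_ground_point)
qed

lemma cell_point_in_seg: "u \<in> {0..1} \<Longrightarrow> torus_proj (cell_point x (Inr e) u) \<in> seg x e"
  unfolding seg_eq image_image place_ground_point by blast

lemma ground_point_edge_eq:
  "ground_point (Inr e) u = ground_point (Inr f) u' \<Longrightarrow>
    (e = f \<and> u = u') \<or> (u \<in> {0,1} \<and> u' \<in> {0,1} \<and>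
      (\<exists>v\<in>{tail Q e, head Q e} \<inter> {tail Q f, head Q f}. ground_point (Inr e) u = node v))"
  by (auto simp: ground_point_def split: if_splits)

lemma ground_point_edge_node: "ground_point (Inr e) u = node v \<Longrightarrow> v \<in> {tail Q e, head Q e}"
  by (auto simp: ground_point_def split: if_splits)

lemma embedded_ground_point_eq:
  assumes "embedded x" "c \<in> cells" "c' \<in> cells" "u \<in> {0..1}" "u' \<in> {0..1}"
    "torus_proj (cell_point x c u) = torus_proj (cell_point x c' u')"
  shows "ground_point c u = ground_point c' u'"
  using assms ground_point_in_ground unfolding embedded_def place_ground_point[symmetric] by (meson inj_onD)

lemma embedded_edge_ends:
  assumes "embedded x" "e \<in> arcs Q" shows "pos x (src (Inr e)) \<noteq> pos x (tgt (Inr e))"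
proof
  assume "pos x (src (Inr e)) = pos x (tgt (Inr e))"
  then have "cell_point x (Inr e) u = pos x (src (Inr e))" for u by (simp add: cell_point_def algebra_simps)
  then have "ground_point (Inr e) (1/3) = ground_point (Inr e) (1/2)"
    using assms by (intro embedded_ground_point_eq[OF assms(1)]) auto
  then show False by (simp add: ground_point_def)
qed

lemma embedded_simple_segment:
  assumes "embedded x" "e \<in> arcs Q"
  shows "simple_segment (pos x (src (Inr e))) (pos x (tgt (Inr e)))"
  unfolding simple_segment_iff cell_point_def[symmetric]
proof (intro conjI ballI impI)
  fix u u' assume "u \<in> {0..1::real}" "u' \<in> {0..1::real}" "torus_proj (cell_point x (Inr e) u) = torus_proj (cell_point x (Inr e) u')"
  then have "ground_point (Inr e) u = ground_point (Inr e) u'" using assms by (intro embedded_ground_point_eq[OF assms(1)]) auto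
  then show "u = u' \<or> {u, u'} = {0, 1}" using ground_point_edge_eq[of e u e u'] by auto
qed (rule embedded_edge_ends[OF assms])

text \<open>Injectivity of the map from the abstract graph to the torus expresses all clauses of a faithful
  placement at once, as any two points of the knot that coincide must be the same abstract point.\<close>

lemma embedded_faithful:
  assumes "embedded x"
  shows "faithful_placement Q (\<lambda>v. torus_proj (pt x v)) (seg x)"
  unfolding faithful_placement_def
proof (intro conjI ballI impI)
  have inj: "inj_on (place x) ground" using assms by (simp add: embedded_def)
  show "inj_on (\<lambda>v. torus_proj (pt x v)) (verts Q)"
  proof (rule inj_onI)
    fix v w assume "v \<in> verts Q" "w \<in> verts Q" "torus_proj (pt x v) = torus_proj (pt x w)"
    then have "node v = node w" by (intro inj_onD[OF inj]) auto
    then show "v = w" by simp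
  qed
  show "(\<lambda>v. torus_proj (pt x v)) ` verts Q \<subseteq> torus" using torus_proj_in_torus by auto
  show "\<exists>k l. edge_lift (seg x e) (torus_proj (pt x (tail Q e))) k (torus_proj (pt x (head Q e))) l"
    if e: "e \<in> arcs Q" for e
  proof -
    have "\<exists>k. torus_proj a + int_vec k = a" for a
      using torus_proj_eq_iff[of a "torus_proj a"] torus_proj_torus[OF torus_proj_in_torus[of a]] by metis
    then obtain k l where k: "torus_proj (pt x (tail Q e)) + int_vec k = pt x (tail Q e)"
      and l: "torus_proj (pt x (head Q e)) + int_vec l = pt x (head Q e)" by metis
    have "torus_proj (pt x (tail Q e)) + int_vec k = pos x (src (Inr e))"
      using k by (simp add: pos_def)
    moreover have "torus_proj (pt x (head Q e)) + int_vec (l - h e) = pos x (tgt (Inr e))"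
      using l by (simp add: pos_def int_vec_diff int_vec_minus algebra_simps)
    ultimately show ?thesis
      unfolding edge_lift_def
      using embedded_simple_segment[OF assms e] by (metis seg_def)
  qed
  show "v \<in> {tail Q e, head Q e}"
    if e: "e \<in> arcs Q" and v: "v \<in> verts Q" and m: "torus_proj (pt x v) \<in> seg x e" for e v
  proof -
    obtain u where u: "u \<in> {0..1}" "place x (node v) = place x (ground_point (Inr e) u)"
      using m by (auto simp: seg_eq)
    then have "ground_point (Inr e) u = node v"
      using e v by (intro inj_onD[OF inj]) (auto intro: ground_point_in_ground)
    then show ?thesis by (rule ground_point_edge_node)
  qed
  show "seg x e \<inter> seg x f \<subseteq> (\<lambda>v. torus_proj (pt x v)) ` ({tail Q e, head Q e} \<inter> {tail Q f, head Q f})"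
    if e: "e \<in> arcs Q" and f: "f \<in> arcs Q" and ef: "e \<noteq> f" for e f
  proof
    fix q assume "q \<in> seg x e \<inter> seg x f"
    then obtain u u' where u: "u \<in> {0..1}" "q = place x (ground_point (Inr e) u)" "u' \<in> {0..1}" "q = place x (ground_point (Inr f) u')"
      unfolding seg_eq by auto
    then have "ground_point (Inr e) u = ground_point (Inr f) u'"
      using e f by (intro inj_onD[OF inj]) (auto intro: ground_point_in_ground)
    then obtain v where "v \<in> {tail Q e, head Q e} \<inter> {tail Q f, head Q f}" "ground_point (Inr e) u = node v"
      using ground_point_edge_eq[of e u f u'] ef by blast
    then show "q \<in> (\<lambda>v. torus_proj (pt x v)) ` ({tail Q e, head Q e} \<inter> {tail Q f, head Q f})"
      using u(2) by auto
  qed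
qed

lemma embedded_inj_seg: "embedded x \<Longrightarrow> inj_on (seg x) (arcs Q)"
proof (rule inj_onI)
  fix e f assume x: "embedded x" and ef: "e \<in> arcs Q" "f \<in> arcs Q" "seg x e = seg x f"
  have "place x (ground_point (Inr e) (1/2)) \<in> seg x e" unfolding seg_eq by auto
  then have "place x (ground_point (Inr e) (1/2)) \<in> seg x f" by (simp only: ef(3))
  then obtain u where u: "u \<in> {0..1}" "place x (ground_point (Inr e) (1/2)) = place x (ground_point (Inr f) u)"
    unfolding seg_eq by auto
  then have "ground_point (Inr e) (1/2) = ground_point (Inr f) u"
    using x ef unfolding embedded_def by (intro inj_onD[of "place x" ground]) (auto intro: ground_point_in_ground)
  then show "e = f" using ground_point_edge_eq[of e "1/2" f u] by auto
qed

text \<open>The vertices are renamed to their nodes and the edges to their segments, which is possible since both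
  are determined by their images.\<close>

lemma embedded_linear_graph_knot:
  assumes "embedded x" shows "linear_graph_knot (knot x)"
proof -
  define p where "p v = torus_proj (pt x v)" for v
  define s where "s = seg x"
  define r where "r = inv_into (arcs Q) s"
  have r: "r (s e) = e" if "e \<in> arcs Q" for e
    using embedded_inj_seg[OF assms] that by (simp add: r_def s_def)
  define H :: "(real^3, (real^3) set) pre_digraph" where
    "H = \<lparr>verts = p ` verts Q, arcs = s ` arcs Q, tail = (\<lambda>t. p (tail Q (r t))), head = (\<lambda>t. p (head Q (r t)))\<rparr>"
  have "fin_digraph H"
    by unfold_locales (auto simp: H_def r)
  moreover have "faithful_placement H id id"
  proof -
    have F: "faithful_placement Q p s" using embedded_faithful[OF assms] unfolding p_def[abs_def] s_def .
    then have inj: "inj_on p (verts Q)" by (simp add: faithful_placement_def)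
    show ?thesis
      unfolding faithful_placement_def
    proof (intro conjI ballI impI)
      show "id ` verts H \<subseteq> torus" using F by (auto simp: H_def faithful_placement_def)
      show "\<exists>k l. edge_lift (id t) (id (tail H t)) k (id (head H t)) l" if "t \<in> arcs H" for t
        using F that by (auto simp: H_def r faithful_placement_def)
      show "v \<in> {tail H t, head H t}" if "t \<in> arcs H" "v \<in> verts H" "id v \<in> id t" for t v
      proof -
        have "t \<in> s ` arcs Q" "v \<in> p ` verts Q" using that(1,2) by (simp_all add: H_def)
        then obtain e w where e: "e \<in> arcs Q" "t = s e" "w \<in> verts Q" "v = p w"
          by blast
        then have "w \<in> {tail Q e, head Q e}" using F that(3) unfolding faithful_placement_def by auto
        then show ?thesis using e by (auto simp: H_def r)
      qed
      show "id t \<inter> id t' \<subseteq> id ` ({tail H t, head H t} \<inter> {tail H t', head H t'})"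
        if "t \<in> arcs H" "t' \<in> arcs H" "t \<noteq> t'" for t t'
      proof -
        have "t \<in> s ` arcs Q" "t' \<in> s ` arcs Q" using that(1,2) by (simp_all add: H_def)
        then obtain e f where e: "e \<in> arcs Q" "t = s e" "f \<in> arcs Q" "t' = s f"
          by blast
        then have "s e \<inter> s f \<subseteq> p ` ({tail Q e, head Q e} \<inter> {tail Q f, head Q f})"
          using that(3) by (intro faithful_placement_disjoint[OF F]) auto
        then show ?thesis using e by (auto simp: H_def r)
      qed
    qed (auto simp: H_def)
  qed
  moreover have "nodes (knot x) = id ` verts H" "segments (knot x) = id ` arcs H"
    by (simp_all add: knot_def nodes_def segments_def H_def p_def[abs_def] s_def)
  ultimately show ?thesis unfolding linear_graph_knot_def by blast
qed

text \<open>The converse of \<open>embedded_faithful\<close>. After a translation by an integer vector, the lift of an edge with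
  the correct label starts at the tail without a shift and so is the lift used by \<open>knot\<close>.\<close>

lemma labelled_knot_embedded:
  assumes "has_labelled_quotient_graph K Q h"
  shows "\<exists>x. embedded x \<and> K = knot x \<and> (\<forall>v\<in>verts Q. \<forall>i. 0 \<le> x (v, i) \<and> x (v, i) < 1)"
proof -
  obtain p s where ps: "faithful_placement Q p s \<and>
        nodes K = p ` verts Q \<and> segments K = s ` arcs Q \<and>
        (\<forall>e\<in>arcs Q. \<exists>k l. edge_lift (s e) (p (tail Q e)) k (p (head Q e)) l \<and> h e = k - l)"
    using assms unfolding has_labelled_quotient_graph_def by (elim exE) (rule that)
  then have F: "faithful_placement Q p s"
    and K: "nodes K = p ` verts Q" "segments K = s ` arcs Q"
    and lab: "\<And>e. e \<in> arcs Q \<Longrightarrow> \<exists>k l. edge_lift (s e) (p (tail Q e)) k (p (head Q e)) l \<and> h e = k - l"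
    by simp_all
  define x where "x = (\<lambda>(v, i). p v $ i)"
  have pt: "pt x v = p v" for v by (simp add: pt_def x_def vec_eq_iff)
  have tor: "p v \<in> torus" if "v \<in> verts Q" for v using F that by (auto simp: faithful_placement_def)
  have proj: "torus_proj (pt x v) = p v" if "v \<in> verts Q" for v
    using tor[OF that] by (simp add: pt torus_proj_torus)
  have lift: "simple_segment (pos x (src (Inr e))) (pos x (tgt (Inr e)))" "s e = seg x e" if e: "e \<in> arcs Q" for e
  proof -
    obtain k l where kl: "edge_lift (s e) (p (tail Q e)) k (p (head Q e)) l" "h e = k - l" using lab[OF e] by blast
    have "l - k = - h e" using kl(2) by simp
    then show "simple_segment (pos x (src (Inr e))) (pos x (tgt (Inr e)))" "s e = seg x e"
      using kl(1) unfolding edge_lift_iff seg_def by (simp_all add: pos_def pt)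
  qed
  have edge_self: "ground_point (Inr e) u = ground_point (Inr e) u'"
    if "e \<in> arcs Q" "u \<in> {0..1}" "0 < u'" "u' < 1" "torus_proj (cell_point x (Inr e) u) = torus_proj (cell_point x (Inr e) u')" for e u u'
    using lift(1)[OF that(1)] that(2-) unfolding simple_segment_iff cell_point_def by fastforce
  have node_edge: False if v: "v \<in> verts Q" and e: "e \<in> arcs Q" "0 < u" "u < 1"
    and eq: "torus_proj (pt x v) = torus_proj (cell_point x (Inr e) u)" for v e u
  proof -
    have "place x (ground_point (Inr e) u) \<in> seg x e" unfolding seg_eq using e by auto
    then have "p v \<in> s e" using eq proj[OF v] lift(2)[OF e(1)] by (simp add: place_ground_point)
    then have "v \<in> {tail Q e, head Q e}" using F v e unfolding faithful_placement_def by auto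
    then obtain u' where u': "u' \<in> {0, 1}" "torus_proj (cell_point x (Inr e) u') = torus_proj (pt x v)"
      by (auto simp: cell_point_def torus_proj_pos intro: that[of 0] that[of 1])
    then have "ground_point (Inr e) u' = ground_point (Inr e) u" using e eq by (intro edge_self) auto
    then show False using u'(1) e by (auto simp: ground_point_def)
  qed
  have "inj_on (place x) ground"
  proof (rule inj_onI)
    fix z z' assume z: "z \<in> ground" "z' \<in> ground" "place x z = place x z'"
    from z(1) show "z = z'"
    proof (cases rule: ground_cases)
      case v: (1 v)
      from z(2) show ?thesis
      proof (cases rule: ground_cases)
        case w: (1 w)
        then have "p v = p w" using z(3) v proj by simp
        then have "v = w" using F v w by (auto simp: faithful_placement_def inj_on_def)
        then show ?thesis using v w by simp
      next
        case (2 e u)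
        then show ?thesis using z(3) v node_edge by (auto simp: place_def node_def cell_point_node)
      qed
    next
      case e: (2 e u)
      from z(2) show ?thesis
      proof (cases rule: ground_cases)
        case (1 v)
        then show ?thesis using z(3) e node_edge[of v e u] by (auto simp: place_def node_def cell_point_node)
      next
        case f: (2 f u')
        show ?thesis
        proof (cases "e = f")
          case True
          then have "ground_point (Inr e) u = ground_point (Inr e) u'"
            using z(3) e f by (intro edge_self) (auto simp: place_def)
          then show ?thesis using True e f by (simp add: ground_point_def)
        next
          case False
          have "place x z \<in> s e" "place x z \<in> s f"
            using cell_point_in_seg[of u x e] cell_point_in_seg[of u' x f] lift(2)[OF e(2)] lift(2)[OF f(2)] e f z(3)
            by (simp_all add: place_def)
          then have "place x z \<in> p ` ({tail Q e, head Q e} \<inter> {tail Q f, head Q f})"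
            using faithful_placement_disjoint[OF F e(2) f(2) False] by blast
          then obtain w where w: "w \<in> {tail Q e, head Q e}" "place x z = p w" by auto
          then have wv: "w \<in> verts Q" using e(2) by auto
          have "torus_proj (pt x w) = torus_proj (cell_point x (Inr e) u)"
            using w(2) proj[OF wv] e(1) by (simp add: place_def)
          then show ?thesis using node_edge[OF wv e(2-4)] by simp
        qed
      qed
    qed
  qed
  moreover have "K = knot x"
  proof (rule prod_eqI)
    show "fst K = fst (knot x)" using K(1) proj by (simp add: nodes_def knot_def)
    show "snd K = snd (knot x)" using K(2) lift(2) by (simp add: segments_def knot_def)
  qed
  moreover have "0 \<le> x (v, i) \<and> x (v, i) < 1" if "v \<in> verts Q" for v i
    using tor[OF that] by (simp add: torus_def x_def)
  ultimately show ?thesis unfolding embedded_def by blast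
qed

end

section \<open>Linear isotopies from paths of configurations\<close>

definition carrier_of :: "graph_knot \<Rightarrow> (real^3) set" where
  "carrier_of K = body K \<union> nodes K"

text \<open>The conditions of a linear isotopy at a single time.\<close>

definition stage :: "graph_knot \<Rightarrow> graph_knot \<Rightarrow> (real^3 \<Rightarrow> real^3) \<Rightarrow> bool" where
  "stage K0 K1 g \<longleftrightarrow> linear_graph_knot K1 \<and> bij_betw g (carrier_of K0) (carrier_of K1) \<and>
     continuous_map (subtopology torus_topology (carrier_of K0)) (subtopology torus_topology (carrier_of K1)) g \<and>
     g ` nodes K0 = nodes K1 \<and> (\<lambda>e. g ` e) ` segments K0 = segments K1"

lemma linearly_isotopic_iff:
  "linearly_isotopic K0 K1 \<longleftrightarrow>
    (\<exists>K f. K 0 = K0 \<and> K 1 = K1 \<and> (\<forall>t\<in>{0..1::real}. stage K0 (K t) (f t)) \<and>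
       (\<forall>x\<in>carrier_of K0. f 0 x = x) \<and>
       (\<forall>x\<in>carrier_of K0. continuous_map (top_of_set {0..1}) torus_topology (\<lambda>t. f t x)))"
  unfolding linearly_isotopic_def stage_def carrier_of_def ..

lemma stage_trans:
  assumes "stage K0 K1 f" "stage K1 K2 g" shows "stage K0 K2 (g \<circ> f)"
proof -
  have "(\<lambda>e. (g \<circ> f) ` e) ` segments K0 = (\<lambda>e. g ` e) ` ((\<lambda>e. f ` e) ` segments K0)"
    by (simp add: image_image image_comp)
  moreover have "(g \<circ> f) ` nodes K0 = g ` (f ` nodes K0)"
    by (simp add: image_comp)
  ultimately show ?thesis
    using assms unfolding stage_def by (auto intro: bij_betw_trans continuous_map_compose)
qed

text \<open>The second isotopy is run after the first one and acts on the points that the first one has arrived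
  at.\<close>

lemma linearly_isotopic_trans:
  assumes "linearly_isotopic K0 K1" "linearly_isotopic K1 K2"
  shows "linearly_isotopic K0 K2"
proof -
  from assms(1) obtain K f where K: "K 0 = K0 \<and> K 1 = K1 \<and> (\<forall>t\<in>{0..1::real}. stage K0 (K t) (f t)) \<and>
       (\<forall>x\<in>carrier_of K0. f 0 x = x) \<and>
       (\<forall>x\<in>carrier_of K0. continuous_map (top_of_set {0..1}) torus_topology (\<lambda>t. f t x))"
    unfolding linearly_isotopic_iff by (elim exE) (rule that)
  from assms(2) obtain K' f' where K': "K' 0 = K1 \<and> K' 1 = K2 \<and> (\<forall>t\<in>{0..1::real}. stage K1 (K' t) (f' t)) \<and>
       (\<forall>x\<in>carrier_of K1. f' 0 x = x) \<and>
       (\<forall>x\<in>carrier_of K1. continuous_map (top_of_set {0..1}) torus_topology (\<lambda>t. f' t x))"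
    unfolding linearly_isotopic_iff by (elim exE) (rule that)
  have st1: "stage K0 K1 (f 1)" using K by auto
  then have f1: "f 1 x \<in> carrier_of K1" if "x \<in> carrier_of K0" for x
    using that by (auto simp: stage_def bij_betw_def)
  define L where "L t = (if t \<le> 1/2 then K (2 * t) else K' (2 * t - 1))" for t :: real
  define g where "g t = (if t \<le> 1/2 then f (2 * t) else f' (2 * t - 1) \<circ> f 1)" for t :: real
  have "stage K0 (L t) (g t)" if "t \<in> {0..1}" for t
    using that K K' stage_trans[OF st1] by (simp add: L_def g_def)
  moreover have "continuous_map (top_of_set {0..1}) torus_topology (\<lambda>t. g t x)" if x: "x \<in> carrier_of K0" for x
  proof -
    have 1: "continuous_map (top_of_set {0..1}) torus_topology (\<lambda>t. f t x)" using K x by simp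
    have 2: "continuous_map (top_of_set {0..1}) torus_topology (\<lambda>t. f' t (f 1 x))" using K' f1[OF x] by simp
    have "continuous_map (top_of_set {0..1}) torus_topology
        (\<lambda>t. if t \<le> 1/2 then f (2 * t) x else f' (2 * t - 1) (f 1 x))"
    proof (rule continuous_map_cases_le)
      show "continuous_map (subtopology (top_of_set {0..1}) {t \<in> topspace (top_of_set {0..1}). t \<le> 1/2})
          torus_topology (\<lambda>t. f (2 * t) x)"
        by (rule continuous_map_compose[OF _ 1, unfolded o_def])
          (auto simp: subtopology_subtopology intro!: continuous_intros)
      show "continuous_map (subtopology (top_of_set {0..1}) {t \<in> topspace (top_of_set {0..1}). 1/2 \<le> t})
          torus_topology (\<lambda>t. f' (2 * t - 1) (f 1 x))"
        by (rule continuous_map_compose[OF _ 2, unfolded o_def])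
          (auto simp: subtopology_subtopology intro!: continuous_intros)
      show "f (2 * t) x = f' (2 * t - 1) (f 1 x)" if "t = 1/2" for t
      proof -
        have t: "2 * t = 1" "2 * t - 1 = 0" using that by simp_all
        show ?thesis unfolding t using K' f1[OF x] by simp
      qed
    qed (auto intro!: continuous_intros)
    moreover have "(\<lambda>t. g t x) = (\<lambda>t. if t \<le> 1/2 then f (2 * t) x else f' (2 * t - 1) (f 1 x))"
      by (auto simp: g_def)
    ultimately show ?thesis by simp
  qed
  moreover have "L 0 = K0" "L 1 = K2" "\<forall>x\<in>carrier_of K0. g 0 x = x"
    using K K' by (simp_all add: L_def g_def)
  ultimately show ?thesis unfolding linearly_isotopic_iff by (intro exI[of _ L] exI[of _ g]) simp
qed

context labelled_graph
begin

lemma carrier_knot: "carrier_of (knot x) = place x ` ground"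
proof (intro equalityI subsetI)
  fix q assume "q \<in> carrier_of (knot x)"
  then consider v where "v \<in> verts Q" "q = torus_proj (pt x v)" | e where "e \<in> arcs Q" "q \<in> seg x e"
    by (auto simp: carrier_of_def body_def nodes_def segments_def knot_def)
  then show "q \<in> place x ` ground"
  proof cases
    case 1
    then have "q = place x (node v)" "node v \<in> ground" by simp_all
    then show ?thesis by blast
  next
    case 2
    then show ?thesis using ground_point_in_ground[of "Inr e"] unfolding seg_eq by auto
  qed
next
  fix q assume "q \<in> place x ` ground"
  then obtain z where z: "z \<in> ground" "q = place x z" by blast
  from z(1) show "q \<in> carrier_of (knot x)"
  proof (cases rule: ground_cases)
    case (1 v)
    then show ?thesis using z by (auto simp: carrier_of_def nodes_def knot_def)
  next
    case (2 e u)
    then have "q \<in> seg x e" using z cell_point_in_seg[of u x e] by (simp add: place_def)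
    then show ?thesis using 2 by (auto simp: carrier_of_def body_def segments_def knot_def)
  qed
qed

text \<open>Moves each point of the knot of \<open>x\<close> to the point of the knot of \<open>y\<close> that represents the same abstract
  point.\<close>

definition transport :: "('v \<times> 3 \<Rightarrow> real) \<Rightarrow> ('v \<times> 3 \<Rightarrow> real) \<Rightarrow> real^3 \<Rightarrow> real^3" where
  "transport x y = place y \<circ> inv_into ground (place x)"

lemma transport_place: "embedded x \<Longrightarrow> z \<in> ground \<Longrightarrow> transport x y (place x z) = place y z"
  by (simp add: transport_def embedded_def)

lemma continuous_cell_point: "continuous_on S (cell_point x c)"
  unfolding cell_point_def by (intro continuous_intros)

lemma place_in_torus: "place x z \<in> torus"
  by (simp add: place_def torus_proj_in_torus)

text \<open>The preimage of a closed set is the union, over the finitely many cells, of the images of closed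
  sets of parameters. These images are projections of compact sets and therefore closed.\<close>

lemma transport_continuous:
  assumes "embedded x"
  shows "continuous_map (subtopology torus_topology (place x ` ground)) torus_topology (transport x y)"
  unfolding continuous_map_closedin
proof (intro conjI allI impI)
  have top: "topspace (subtopology torus_topology (place x ` ground)) = place x ` ground"
    using place_in_torus by (auto simp: topspace_torus_topology)
  show "transport x y \<in> topspace (subtopology torus_topology (place x ` ground)) \<rightarrow> topspace torus_topology"
    unfolding top topspace_torus_topology using transport_place[OF assms] place_in_torus by auto
  fix C assume C: "closedin torus_topology C"
  define A where "A c = {u \<in> {0..1}. torus_proj (cell_point y c u) \<in> C}" for c
  have "closedin torus_topology (torus_proj ` cell_point x c ` A c)" for c
  proof (intro closedin_torus_proj_compact compact_continuous_image continuous_cell_point)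
    have "continuous_map (top_of_set {0..1}) torus_topology (torus_proj \<circ> cell_point y c)"
      by (rule continuous_map_compose[OF _ continuous_map_torus_proj]) (simp add: continuous_cell_point)
    then have "closedin (top_of_set {0..1}) (A c)"
      using closedin_continuous_map_preimage[OF _ C] by (fastforce simp: A_def)
    then show "compact (A c)" using closedin_compact compact_Icc by blast
  qed
  then have "closedin torus_topology (\<Union>c\<in>cells. torus_proj ` cell_point x c ` A c)"
    using finite_cells by (intro closedin_Union) auto
  moreover have "{q \<in> place x ` ground. transport x y q \<in> C} = (\<Union>c\<in>cells. torus_proj ` cell_point x c ` A c) \<inter> place x ` ground"
  proof (intro equalityI subsetI)
    fix q assume "q \<in> {q \<in> place x ` ground. transport x y q \<in> C}"
    then obtain c u where z: "(c, u) \<in> ground" "q = place x (c, u)" "place y (c, u) \<in> C"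
      using transport_place[OF assms] by auto
    then have "c \<in> cells" "u \<in> A c" "q = torus_proj (cell_point x c u)"
      by (auto simp: ground_def A_def place_def)
    then show "q \<in> (\<Union>c\<in>cells. torus_proj ` cell_point x c ` A c) \<inter> place x ` ground"
      using z by blast
  next
    fix q assume "q \<in> (\<Union>c\<in>cells. torus_proj ` cell_point x c ` A c) \<inter> place x ` ground"
    then obtain c u where c: "c \<in> cells" "u \<in> A c" "q = torus_proj (cell_point x c u)" and q: "q \<in> place x ` ground" by blast
    have "q = place x (ground_point c u)" "ground_point c u \<in> ground"
      using c ground_point_in_ground by (auto simp: place_ground_point A_def)
    then have "transport x y q = torus_proj (cell_point y c u)"
      using transport_place[OF assms, of "ground_point c u" y] by (simp add: place_ground_point)
    then show "q \<in> {q \<in> place x ` ground. transport x y q \<in> C}"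
      using q c(2) by (simp add: A_def)
  qed
  ultimately show "closedin (subtopology torus_topology (place x ` ground))
      {q \<in> topspace (subtopology torus_topology (place x ` ground)). transport x y q \<in> C}"
    unfolding top closedin_subtopology by blast
qed

lemma transport_seg:
  assumes "embedded x" "e \<in> arcs Q" shows "transport x y ` seg x e = seg y e"
proof -
  have "transport x y (place x (ground_point (Inr e) u)) = place y (ground_point (Inr e) u)" if "u \<in> {0..1}" for u
    using assms that by (intro transport_place ground_point_in_ground) auto
  then show ?thesis unfolding seg_eq image_image by (intro image_cong) auto
qed

lemma transport_stage:
  assumes "embedded x" "embedded y" shows "stage (knot x) (knot y) (transport x y)"
  unfolding stage_def carrier_knot
proof (intro conjI)
  show "linear_graph_knot (knot y)" by (rule embedded_linear_graph_knot[OF assms(2)])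
  have "bij_betw (inv_into ground (place x)) (place x ` ground) ground"
    by (rule bij_betw_inv_into) (use assms(1) in \<open>simp add: embedded_def bij_betw_def\<close>)
  moreover have "bij_betw (place y) ground (place y ` ground)"
    using assms(2) by (simp add: embedded_def bij_betw_def)
  ultimately show "bij_betw (transport x y) (place x ` ground) (place y ` ground)"
    unfolding transport_def by (rule bij_betw_trans)
  show "continuous_map (subtopology torus_topology (place x ` ground)) (subtopology torus_topology (place y ` ground)) (transport x y)"
    using transport_continuous[OF assms(1)] transport_place[OF assms(1)]
    by (auto simp: continuous_map_in_subtopology)
  have "transport x y (torus_proj (pt x v)) = torus_proj (pt y v)" if "v \<in> verts Q" for v
    using transport_place[OF assms(1), of "node v"] that by simp
  then show "transport x y ` nodes (knot x) = nodes (knot y)"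
    unfolding nodes_def knot_def fst_conv image_image by (intro image_cong) auto
  show "(\<lambda>e. transport x y ` e) ` segments (knot x) = segments (knot y)"
    unfolding segments_def knot_def snd_conv image_image
    using transport_seg[OF assms(1)] by (intro image_cong) auto
qed

lemma continuous_pos:
  assumes "continuous_on S \<gamma>" shows "continuous_on S (\<lambda>t. pos (\<gamma> t) w)"
  unfolding pos_def pt_def
  by (intro continuous_intros continuous_on_vec_lambda continuous_on_product_then_coordinatewise[OF assms])

lemma embedded_path_isotopic:
  assumes "path_component {x. embedded x} x y"
  shows "linearly_isotopic (knot x) (knot y)"
proof -
  obtain \<gamma> where \<gamma>: "path \<gamma>" "path_image \<gamma> \<subseteq> {x. embedded x}" "pathstart \<gamma> = x" "pathfinish \<gamma> = y"
    using assms by (auto simp: path_component_def)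
  have g: "embedded (\<gamma> t)" if "t \<in> {0..1}" for t
  proof -
    have "\<gamma> t \<in> path_image \<gamma>" using that by (simp add: path_image_def)
    then show ?thesis using \<gamma>(2) by blast
  qed
  have ends: "\<gamma> 0 = x" "\<gamma> 1 = y" using \<gamma> by (simp_all add: pathstart_def pathfinish_def)
  have x: "embedded x" using g[of 0] ends by simp
  have "continuous_map (top_of_set {0..1}) torus_topology (\<lambda>t. transport x (\<gamma> t) q)" if "q \<in> place x ` ground" for q
  proof -
    obtain z where z: "z \<in> ground" "q = place x z" using \<open>q \<in> place x ` ground\<close> by blast
    have "continuous_on {0..1} (\<lambda>t. cell_point (\<gamma> t) (fst z) (snd z))"
      unfolding cell_point_def
      by (intro continuous_on_add continuous_on_scaleR continuous_on_const continuous_pos)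
        (use \<gamma>(1) in \<open>simp_all add: path_def\<close>)
    then have "continuous_map (top_of_set {0..1}) torus_topology (torus_proj \<circ> (\<lambda>t. cell_point (\<gamma> t) (fst z) (snd z)))"
      by (intro continuous_map_compose[OF _ continuous_map_torus_proj]) simp
    then show ?thesis
      unfolding z(2) transport_place[OF x z(1)] by (simp add: place_def o_def)
  qed
  moreover have "transport x x q = q" if "q \<in> place x ` ground" for q
    using that transport_place[OF x] by auto
  ultimately show ?thesis
    unfolding linearly_isotopic_iff carrier_knot using ends transport_stage[OF x] g
    by (intro exI[of _ "\<lambda>t. knot (\<gamma> t)"] exI[of _ "\<lambda>t. transport x (\<gamma> t)"]) auto
qed

end

section \<open>Meeting of two segments as a condition on signs\<close>

definition meets1 :: "real \<Rightarrow> real \<Rightarrow> real \<Rightarrow> bool" where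
  "meets1 a b c \<longleftrightarrow> (\<exists>u\<in>{0<..<1}. \<exists>u'\<in>{0<..<1}. u * a - u' * c = b)"

text \<open>The possible values form an open interval, or the point \<open>0\<close> if \<open>a = c = 0\<close>.\<close>

lemma meets1_iff:
  "meets1 a b c \<longleftrightarrow> (a = 0 \<and> c = 0 \<and> b = 0) \<or>
     ((a \<noteq> 0 \<or> c \<noteq> 0) \<and> min 0 a + min 0 (- c) < b \<and> b < max 0 a + max 0 (- c))"
proof
  assume "meets1 a b c"
  then obtain u u' where u: "0 < u" "u < 1" "0 < u'" "u' < 1" and b: "b = u * a + u' * (- c)"
    by (auto simp: meets1_def)
  have range: "v * w = 0 \<and> w = 0 \<or> (w \<noteq> 0 \<and> min 0 w < v * w \<and> v * w < max 0 w)"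
    if "0 < v" "v < 1" for v w :: real
    using that by (cases w "0::real" rule: linorder_cases) (auto simp: mult_pos_neg)
  show "(a = 0 \<and> c = 0 \<and> b = 0) \<or>
     ((a \<noteq> 0 \<or> c \<noteq> 0) \<and> min 0 a + min 0 (- c) < b \<and> b < max 0 a + max 0 (- c))"
    using range[OF u(1,2), of a] range[OF u(3,4), of "- c"] unfolding b by auto
next
  assume "(a = 0 \<and> c = 0 \<and> b = 0) \<or>
     ((a \<noteq> 0 \<or> c \<noteq> 0) \<and> min 0 a + min 0 (- c) < b \<and> b < max 0 a + max 0 (- c))"
  then show "meets1 a b c"
  proof
    assume "a = 0 \<and> c = 0 \<and> b = 0"
    then show ?thesis unfolding meets1_def by (intro bexI[of _ "1/2"]) auto
  next
    assume *: "(a \<noteq> 0 \<or> c \<noteq> 0) \<and> min 0 a + min 0 (- c) < b \<and> b < max 0 a + max 0 (- c)"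
    define lo hi where "lo = min 0 a + min 0 (- c)" and "hi = max 0 a + max 0 (- c)"
    \<comment> \<open>As \<open>\<theta>\<close> runs from \<open>0\<close> to \<open>1\<close>, both summands run linearly from their minimum to their maximum;
      the parameters run backwards where the coefficient is negative.\<close>
    define \<theta> where "\<theta> = (b - lo) / (hi - lo)"
    have \<theta>: "0 < \<theta>" "\<theta> < 1" and b: "\<theta> * (hi - lo) = b - lo"
      using * by (auto simp: \<theta>_def lo_def hi_def field_simps)
    define u where "u = (if a \<ge> 0 then \<theta> else 1 - \<theta>)"
    define u' where "u' = (if c \<ge> 0 then 1 - \<theta> else \<theta>)"
    have "u * a - u' * c = lo + \<theta> * (hi - lo)"
      by (auto simp: u_def u'_def lo_def hi_def min_def max_def algebra_simps)
    moreover have "u \<in> {0<..<1}" "u' \<in> {0<..<1}" using \<theta> by (auto simp: u_def u'_def)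
    ultimately show ?thesis using b unfolding meets1_def by (intro bexI[of _ u] bexI[of _ u']) auto
  qed
qed

lemma sgn_eqD:
  fixes p q :: real
  assumes "sgn p = sgn q"
  shows "p < 0 \<longleftrightarrow> q < 0" "p > 0 \<longleftrightarrow> q > 0" "p = 0 \<longleftrightarrow> q = 0"
  using assms by (auto simp: sgn_if split: if_splits)

lemma meets1_sgn:
  assumes "sgn a = sgn a'" "sgn c = sgn c'" "sgn b = sgn b'" "sgn (b - a) = sgn (b' - a')"
    "sgn (b + c) = sgn (b' + c')" "sgn (b - a + c) = sgn (b' - a' + c')" "meets1 a b c"
  shows "meets1 a' b' c'"
proof -
  note s = sgn_eqD[OF assms(1)] sgn_eqD[OF assms(2)] sgn_eqD[OF assms(3)] sgn_eqD[OF assms(4)]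
    sgn_eqD[OF assms(5)] sgn_eqD[OF assms(6)]
  consider "a = 0" "c = 0" | "a = 0" "c > 0" | "a = 0" "c < 0" | "a > 0" "c = 0" | "a < 0" "c = 0"
    | "a > 0" "c > 0" | "a > 0" "c < 0" | "a < 0" "c > 0" | "a < 0" "c < 0" by linarith
  then show ?thesis
    using assms(7) s unfolding meets1_iff by cases (simp_all; linarith)+
qed

definition meets :: "real^3 \<Rightarrow> real^3 \<Rightarrow> real^3 \<Rightarrow> bool" where
  "meets A B C \<longleftrightarrow> (\<exists>u\<in>{0<..<1}. \<exists>u'\<in>{0<..<1}. u *\<^sub>R A - u' *\<^sub>R C = B)"

text \<open>The two-by-two minors of the matrix with the columns \<open>A\<close> and \<open>C\<close>.\<close>

definition minor :: "real^3 \<Rightarrow> real^3 \<Rightarrow> 3 \<Rightarrow> 3 \<Rightarrow> real" where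
  "minor A C i j = A $ i * C $ j - A $ j * C $ i"

text \<open>If \<open>minor A C i j\<close> is nonzero, Cramer's rule solves the components \<open>i\<close> and \<open>j\<close> of the equation
  \<open>u *\<^sub>R A - u' *\<^sub>R C = B\<close>. The test says whether the solution satisfies the component \<open>k\<close> as well.\<close>

definition det_test :: "3 \<Rightarrow> 3 \<Rightarrow> 3 \<Rightarrow> real^3 \<Rightarrow> real^3 \<Rightarrow> real^3 \<Rightarrow> real" where
  "det_test i j k A B C = minor B C i j * A $ k - minor B A i j * C $ k - minor A C i j * B $ k"

definition sign_tests :: "(real^3 \<Rightarrow> real^3 \<Rightarrow> real^3 \<Rightarrow> real) set" where
  "sign_tests = (\<Union>i. \<Union>j. \<Union>k.
     {\<lambda>A B C. A $ i, \<lambda>A B C. B $ i, \<lambda>A B C. C $ i, \<lambda>A B C. B $ i - A $ i, \<lambda>A B C. B $ i + C $ i,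
      \<lambda>A B C. B $ i - A $ i + C $ i,
      \<lambda>A B C. minor A C i j, \<lambda>A B C. minor B C i j, \<lambda>A B C. minor B A i j,
      \<lambda>A B C. minor A C i j - minor B C i j, \<lambda>A B C. minor A C i j - minor B A i j,
      det_test i j k})"

lemma finite_sign_tests: "finite sign_tests"
  by (simp add: sign_tests_def)

lemma unit_ratio_iff:
  fixes x w :: real
  assumes "x \<noteq> 0"
  shows "w / x \<in> {0<..<1} \<longleftrightarrow> sgn w = sgn x \<and> sgn (x - w) = sgn x"
  using assms by (cases x "0::real" rule: linorder_cases) (auto simp: field_simps sgn_if split: if_splits)

text \<open>If \<open>A\<close> and \<open>C\<close> are linearly independent, Cramer's rule gives the only candidates for the two parameters as
  quotients of minors, and the condition that they solve the system and lie between \<open>0\<close> and \<open>1\<close> is one on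
  signs. Otherwise the vectors must lie on a common line, and a coordinate in which \<open>A\<close> or \<open>C\<close> is nonzero
  reduces the question to \<open>meets1\<close>.\<close>

lemma meets_sign_determined:
  assumes signs: "\<And>s. s \<in> sign_tests \<Longrightarrow> sgn (s A B C) = sgn (s A' B' C')" and "meets A B C"
  shows "meets A' B' C'"
proof -
  obtain u u' where u: "u \<in> {0<..<1}" "u' \<in> {0<..<1}" and eq: "u *\<^sub>R A - u' *\<^sub>R C = B"
    using assms(2) by (auto simp: meets_def)
  have B: "B $ i = u * A $ i - u' * C $ i" for i by (simp add: eq[symmetric])
  have W: "minor B C i j = u * minor A C i j" for i j
    by (simp add: minor_def B algebra_simps)
  have Y: "minor B A i j = u' * minor A C i j" for i j
    by (simp add: minor_def B algebra_simps)
  have E: "det_test i j k A B C = 0" for i j k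
    unfolding det_test_def W Y by (simp add: B algebra_simps)
  have T: "sgn (A $ i) = sgn (A' $ i)" "sgn (B $ i) = sgn (B' $ i)" "sgn (C $ i) = sgn (C' $ i)"
    "sgn (B $ i - A $ i) = sgn (B' $ i - A' $ i)" "sgn (B $ i + C $ i) = sgn (B' $ i + C' $ i)"
    "sgn (B $ i - A $ i + C $ i) = sgn (B' $ i - A' $ i + C' $ i)"
    "sgn (minor A C i j) = sgn (minor A' C' i j)" "sgn (minor B C i j) = sgn (minor B' C' i j)"
    "sgn (minor B A i j) = sgn (minor B' A' i j)"
    "sgn (minor A C i j - minor B C i j) = sgn (minor A' C' i j - minor B' C' i j)"
    "sgn (minor A C i j - minor B A i j) = sgn (minor A' C' i j - minor B' A' i j)" for i j
    by (rule signs; auto simp: sign_tests_def)+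
  have TE: "sgn (det_test i j k A B C) = sgn (det_test i j k A' B' C')" for i j k
    by (rule signs) (auto simp: sign_tests_def)
  show ?thesis
  proof (cases "\<exists>i j. minor A C i j \<noteq> 0")
    case True
    then obtain i j where X: "minor A C i j \<noteq> 0" by blast
    then have X': "minor A' C' i j \<noteq> 0" using sgn_eqD(3)[OF T(7)] by blast
    define v where "v = minor B' C' i j / minor A' C' i j"
    define v' where "v' = minor B' A' i j / minor A' C' i j"
    have "minor B C i j / minor A C i j = u" "minor B A i j / minor A C i j = u'" using X W Y by simp_all
    then have "v \<in> {0<..<1}" "v' \<in> {0<..<1}"
      using u unit_ratio_iff[OF X, of "minor B C i j"] unit_ratio_iff[OF X, of "minor B A i j"]
      unfolding v_def v'_def unit_ratio_iff[OF X'] T by simp_all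
    moreover have "v *\<^sub>R A' - v' *\<^sub>R C' = B'"
    proof -
      have "v * A' $ k - v' * C' $ k = B' $ k" for k
      proof -
        have "det_test i j k A' B' C' = 0" using sgn_eqD(3)[OF TE] E by blast
        then show ?thesis using X' by (simp add: v_def v'_def det_test_def field_simps)
      qed
      then show ?thesis by (simp add: vec_eq_iff)
    qed
    ultimately show ?thesis unfolding meets_def by blast
  next
    case False
    then have X: "minor A C i j = 0" for i j by blast
    then have zero: "minor A' C' i j = 0" "minor B' C' i j = 0" "minor B' A' i j = 0" for i j
      using sgn_eqD(3)[OF T(7)[of i j]] sgn_eqD(3)[OF T(8)[of i j]] sgn_eqD(3)[OF T(9)[of i j]] W[of i j] Y[of i j]
      by simp_all
    show ?thesis
    proof (cases "\<exists>i. A $ i \<noteq> 0 \<or> C $ i \<noteq> 0")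
      case True
      then obtain i where i: "A $ i \<noteq> 0 \<or> C $ i \<noteq> 0" by blast
      then have i': "A' $ i \<noteq> 0 \<or> C' $ i \<noteq> 0"
        using sgn_eqD(3)[OF T(1)[of i]] sgn_eqD(3)[OF T(3)[of i]] by blast
      have "meets1 (A $ i) (B $ i) (C $ i)"
        unfolding meets1_def using u B[of i] by (intro bexI[of _ u] bexI[of _ u']) auto
      then have "meets1 (A' $ i) (B' $ i) (C' $ i)"
        by (rule meets1_sgn[OF T(1,3,2,4,5,6)])
      then obtain v v' where v: "v \<in> {0<..<1}" "v' \<in> {0<..<1}" "v * A' $ i - v' * C' $ i = B' $ i"
        unfolding meets1_def by blast
      have "v * A' $ k - v' * C' $ k = B' $ k" for k
      proof -
        have z: "A' $ i * C' $ k = A' $ k * C' $ i" "B' $ i * C' $ k = B' $ k * C' $ i"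
          "B' $ i * A' $ k = B' $ k * A' $ i"
          using zero[of i k] by (simp_all add: minor_def)
        have "A' $ i * (v * A' $ k - v' * C' $ k) = A' $ k * (v * A' $ i - v' * C' $ i)"
          using z by (simp add: algebra_simps)
        then have 1: "A' $ i * (v * A' $ k - v' * C' $ k) = A' $ i * B' $ k"
          unfolding v(3) using z by (simp add: algebra_simps)
        have "C' $ i * (v * A' $ k - v' * C' $ k) = C' $ k * (v * A' $ i - v' * C' $ i)"
          using z by (simp add: algebra_simps)
        then have 2: "C' $ i * (v * A' $ k - v' * C' $ k) = C' $ i * B' $ k"
          unfolding v(3) using z by (simp add: algebra_simps)
        show ?thesis using i' 1 2 by auto
      qed
      then have "v *\<^sub>R A' - v' *\<^sub>R C' = B'" by (simp add: vec_eq_iff)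
      then show ?thesis using v unfolding meets_def by blast
    next
      case False
      then have "A' $ i = 0" "C' $ i = 0" "B' $ i = 0" for i
        using sgn_eqD(3)[OF T(1)[of i]] sgn_eqD(3)[OF T(3)[of i]] sgn_eqD(3)[OF T(2)[of i]] B[of i] by simp_all
      then have "A' = 0" "B' = 0" "C' = 0" by (simp_all add: vec_eq_iff)
      then show ?thesis using u unfolding meets_def by (intro bexI[of _ u] bexI[of _ u']) auto
    qed
  qed
qed

section \<open>Stability of non-crossing under small moves\<close>

text \<open>The intersection of relative interiors, where a degenerate segment is its own relative interior.\<close>

definition crosses :: "'a::real_vector \<Rightarrow> 'a \<Rightarrow> 'a \<Rightarrow> 'a \<Rightarrow> bool" where
  "crosses a b c d \<longleftrightarrow> (\<exists>u\<in>{0<..<1}. \<exists>u'\<in>{0<..<1}. (1 - u) *\<^sub>R a + u *\<^sub>R b = (1 - u') *\<^sub>R c + u' *\<^sub>R d)"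

lemma crosses_swap_left: "crosses b a c d \<longleftrightarrow> crosses a b c d"
proof -
  have "crosses a b c d" if "crosses b a c d" for a b c d :: 'a
    using that unfolding crosses_def
    by (elim bexE) (rule_tac x = "1 - u" in bexI, rule_tac x = u' in bexI, auto simp: add.commute)
  then show ?thesis by blast
qed

lemma crosses_sym: "crosses c d a b \<longleftrightarrow> crosses a b c d"
  unfolding crosses_def by metis

lemma crosses_swap_right: "crosses a b d c \<longleftrightarrow> crosses a b c d"
  using crosses_swap_left crosses_sym by blast

text \<open>Segments with a common end point come arbitrarily close to each other, so compactness is of no use.
  But they cross only if their directions have the same normalisation, and this is a closed
  condition, which at the start would make them overlap.\<close>

lemma eventually_not_crosses_shared:
  fixes a b d :: "real \<Rightarrow> 'a::real_inner"
  assumes lim: "(a \<longlongrightarrow> a0) F" "(b \<longlongrightarrow> b0) F" "(d \<longlongrightarrow> d0) F"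
    and ne: "b0 \<noteq> a0" "d0 \<noteq> a0" and not: "\<not> crosses a0 b0 a0 d0"
  shows "\<forall>\<^sub>F t in F. \<not> crosses (a t) (b t) (a t) (d t)"
proof -
  define n where "n t = norm (d t - a t) *\<^sub>R (b t - a t) - norm (b t - a t) *\<^sub>R (d t - a t)" for t
  define n0 where "n0 = norm (d0 - a0) *\<^sub>R (b0 - a0) - norm (b0 - a0) *\<^sub>R (d0 - a0)"
  have "(n \<longlongrightarrow> n0) F" unfolding n_def[abs_def] n0_def by (intro tendsto_intros lim)
  moreover have "n0 \<noteq> 0"
  proof
    assume n0: "n0 = 0"
    \<comment> \<open>Division by \<open>L\<close> brings the common multiple of the two directions into both open segments.\<close>
    define L where "L = norm (d0 - a0) + norm (b0 - a0)"
    have pos: "norm (d0 - a0) > 0" "norm (b0 - a0) > 0" using ne by simp_all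
    have ratio: "p / (p + q) \<in> {0<..<1}" "q / (p + q) \<in> {0<..<1}" if "p > 0" "q > 0" for p q :: real
      using that by (auto simp: field_simps)
    have L: "norm (d0 - a0) / L \<in> {0<..<1}" "norm (b0 - a0) / L \<in> {0<..<1}"
      unfolding L_def by (rule ratio[OF pos])+
    have "(norm (d0 - a0) / L) *\<^sub>R (b0 - a0) = (norm (b0 - a0) / L) *\<^sub>R (d0 - a0)"
      using arg_cong[OF n0[unfolded n0_def], of "\<lambda>v. (1 / L) *\<^sub>R v"] by (simp add: scaleR_diff_right)
    then have "crosses a0 b0 a0 d0"
      unfolding crosses_def using L
      by (intro bexI[of _ "norm (d0 - a0) / L"] bexI[of _ "norm (b0 - a0) / L"]) (simp_all add: algebra_simps)
    then show False using not by simp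
  qed
  ultimately have "\<forall>\<^sub>F t in F. n t \<noteq> 0" by (rule tendsto_imp_eventually_ne)
  moreover have "n t = 0" if "crosses (a t) (b t) (a t) (d t)" for t
  proof -
    from that obtain u u' where uu: "u \<in> {0<..<1}" "u' \<in> {0<..<1}"
      "(1 - u) *\<^sub>R a t + u *\<^sub>R b t = (1 - u') *\<^sub>R a t + u' *\<^sub>R d t"
      unfolding crosses_def by blast
    then have u: "0 < u" "0 < u'" by simp_all
    have eq: "u *\<^sub>R (b t - a t) = u' *\<^sub>R (d t - a t)" using uu(3) by (simp add: algebra_simps)
    have "norm (u *\<^sub>R (b t - a t)) = norm (u' *\<^sub>R (d t - a t))" by (simp only: eq)
    then have len: "u * norm (b t - a t) = u' * norm (d t - a t)" using u by simp
    have "u *\<^sub>R n t = norm (d t - a t) *\<^sub>R (u *\<^sub>R (b t - a t)) - (u * norm (b t - a t)) *\<^sub>R (d t - a t)"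
      by (simp add: n_def scaleR_diff_right mult.commute)
    also have "\<dots> = 0" unfolding eq len by (simp add: mult.commute)
    finally show "n t = 0" using u by simp
  qed
  ultimately show ?thesis by (auto elim: eventually_mono)
qed

lemma eventually_not_crosses_disjoint:
  fixes a b c d :: "real \<Rightarrow> 'a::real_normed_vector"
  assumes cont: "continuous_on {0..1} a" "continuous_on {0..1} b" "continuous_on {0..1} c" "continuous_on {0..1} d"
    and disj: "\<And>u u'. u \<in> {0..1} \<Longrightarrow> u' \<in> {0..1} \<Longrightarrow>
      (1 - u) *\<^sub>R a 0 + u *\<^sub>R b 0 \<noteq> (1 - u') *\<^sub>R c 0 + u' *\<^sub>R d 0"
  shows "\<forall>\<^sub>F t in at_right 0. \<not> crosses (a t) (b t) (c t) (d t)"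
proof -
  define \<phi> where "\<phi> z = ((1 - fst (snd z)) *\<^sub>R a (fst z) + fst (snd z) *\<^sub>R b (fst z)) -
      ((1 - snd (snd z)) *\<^sub>R c (fst z) + snd (snd z) *\<^sub>R d (fst z))" for z :: "real \<times> real \<times> real"
  have "continuous_on ({0..1} \<times> UNIV) \<phi>"
    unfolding \<phi>_def
    by (intro continuous_intros continuous_on_compose2[OF cont(1)] continuous_on_compose2[OF cont(2)]
        continuous_on_compose2[OF cont(3)] continuous_on_compose2[OF cont(4)]) auto
  moreover have "compact ({0..1::real} \<times> {0..1::real})" by (intro compact_Times) auto
  ultimately obtain \<delta> where \<delta>: "\<delta> > 0"
    "\<And>t z. t \<in> {0..1} \<Longrightarrow> dist t 0 < \<delta> \<Longrightarrow> z \<in> {0..1} \<times> {0..1} \<Longrightarrow> \<phi> (t, z) \<noteq> 0"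
    using nonvanishing_tube[of \<phi> "{0..1} \<times> {0..1}" 0] disj by (auto simp: \<phi>_def)
  have "\<not> crosses (a t) (b t) (c t) (d t)" if "t > 0" "t < min \<delta> 1" for t
  proof
    assume "crosses (a t) (b t) (c t) (d t)"
    then obtain u u' where "u \<in> {0<..<1}" "u' \<in> {0<..<1}" "(1 - u) *\<^sub>R a t + u *\<^sub>R b t = (1 - u') *\<^sub>R c t + u' *\<^sub>R d t"
      unfolding crosses_def by blast
    then have "(u, u') \<in> {0..1} \<times> {0..1}" "\<phi> (t, (u, u')) = 0" by (auto simp: \<phi>_def)
    moreover have "t \<in> {0..1}" "dist t 0 < \<delta>" using that by auto
    ultimately show False using \<delta>(2) by blast
  qed
  then show ?thesis
    unfolding eventually_at_right_field using \<delta>(1) by (intro exI[of _ "min \<delta> 1"]) auto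
qed



section \<open>Embedded configurations and signs of polynomials\<close>

lemma path_component_sgn:
  fixes f :: "'a::topological_space \<Rightarrow> real"
  assumes "path_component S x y" "continuous_on S f" "\<And>z. z \<in> S \<Longrightarrow> f z \<noteq> 0"
  shows "sgn (f x) = sgn (f y)"
proof -
  obtain g where g: "path g" "path_image g \<subseteq> S" "pathstart g = x" "pathfinish g = y"
    using assms(1) by (auto simp: path_component_def)
  have "connected (f ` path_image g)"
    using g assms(2) by (intro connected_continuous_image connected_path_image) (auto intro: continuous_on_subset)
  moreover have "0 \<notin> f ` path_image g" using assms(3) g(2) by force
  moreover have "f x \<in> f ` path_image g" "f y \<in> f ` path_image g"
    using g pathstart_in_path_image pathfinish_in_path_image by blast+
  ultimately have "\<not> (f x \<le> 0 \<and> 0 \<le> f y)" "\<not> (f y \<le> 0 \<and> 0 \<le> f x)"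
    unfolding connected_iff_interval by blast+
  then show ?thesis by (auto simp: sgn_if)
qed

context labelled_graph
begin

definition direction :: "('v \<times> 3 \<Rightarrow> real) \<Rightarrow> 'v + 'e \<Rightarrow> real^3" where
  "direction x c = pos x (tgt c) - pos x (src c)"

definition offset :: "('v \<times> 3 \<Rightarrow> real) \<Rightarrow> 'v + 'e \<Rightarrow> 'v + 'e \<Rightarrow> int^3 \<Rightarrow> real^3" where
  "offset x c c' m = pos x (src c') + int_vec m - pos x (src c)"

definition collide :: "('v \<times> 3 \<Rightarrow> real) \<Rightarrow> 'v + 'e \<Rightarrow> 'v + 'e \<Rightarrow> int^3 \<Rightarrow> bool" where
  "collide x c c' m \<longleftrightarrow> (\<exists>u\<in>{0<..<1}. \<exists>u'\<in>{0<..<1}. cell_point x c u = cell_point x c' u' + int_vec m)"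

lemma cell_point_direction: "cell_point x c u = pos x (src c) + u *\<^sub>R direction x c"
  by (simp add: cell_point_def direction_def algebra_simps)

lemma collide_meets: "collide x c c' m \<longleftrightarrow> meets (direction x c) (offset x c c' m) (direction x c')"
proof -
  have "cell_point x c u = cell_point x c' u' + int_vec m \<longleftrightarrow> u *\<^sub>R direction x c - u' *\<^sub>R direction x c' = offset x c c' m" for u u'
    unfolding cell_point_direction offset_def by (auto simp: algebra_simps)
  then show ?thesis unfolding collide_def meets_def by simp
qed

lemma cell_point_inj: "direction x c \<noteq> 0 \<Longrightarrow> cell_point x c u = cell_point x c u' \<longleftrightarrow> u = u'"
  by (simp add: cell_point_direction)

text \<open>Two lifts of the cells \<open>c\<close> and \<open>c'\<close> differ by an integer vector \<open>m\<close>, and equality of points in the torus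
  means equality of the points on two such lifts.\<close>

lemma embedded_iff:
  "embedded x \<longleftrightarrow> (\<forall>e\<in>arcs Q. direction x (Inr e) \<noteq> 0) \<and>
     (\<forall>c\<in>cells. \<forall>c'\<in>cells. \<forall>m. c \<noteq> c' \<or> m \<noteq> 0 \<longrightarrow> \<not> collide x c c' m)"
proof (intro iffI conjI ballI allI impI)
  assume embedded: "embedded x"
  show edge: "direction x (Inr e) \<noteq> 0" if "e \<in> arcs Q" for e
    using embedded_edge_ends[OF embedded that] by (simp add: direction_def)
  fix c c' and m :: "int^3" assume c: "c \<in> cells" "c' \<in> cells" "c \<noteq> c' \<or> m \<noteq> 0"
  show "\<not> collide x c c' m"
  proof
    assume "collide x c c' m"
    then obtain u u' where u: "u \<in> {0<..<1}" "u' \<in> {0<..<1}" "cell_point x c u = cell_point x c' u' + int_vec m"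
      unfolding collide_def by blast
    then have "torus_proj (cell_point x c u) = torus_proj (cell_point x c' u')" by simp
    then have g: "ground_point c u = ground_point c' u'" using c u by (intro embedded_ground_point_eq[OF embedded]) auto
    have "c = c' \<and> cell_point x c u = cell_point x c' u'"
      using g u(1,2) by (cases c; cases c') (auto simp: ground_point_def cell_point_node)
    then show False using c(3) u(3) int_vec_eq_iff[of m 0] by (simp del: int_vec_eq_iff)
  qed
next
  assume *: "(\<forall>e\<in>arcs Q. direction x (Inr e) \<noteq> 0) \<and>
     (\<forall>c\<in>cells. \<forall>c'\<in>cells. \<forall>m. c \<noteq> c' \<or> m \<noteq> 0 \<longrightarrow> \<not> collide x c c' m)"
  show "embedded x"
    unfolding embedded_def
  proof (rule inj_onI)
    fix z z' assume z: "z \<in> ground" "z' \<in> ground" "place x z = place x z'"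
    obtain c u c' u' where zz: "z = (c, u)" "z' = (c', u')" by fastforce
    obtain m where m: "cell_point x c u = cell_point x c' u' + int_vec m"
      using z(3) unfolding place_def zz torus_proj_eq_iff by auto
    have c: "c \<in> cells" "c' \<in> cells" "u \<in> {0<..<1}" "u' \<in> {0<..<1}"
      using z zz by (auto simp: ground_def)
    then have "collide x c c' m" using m unfolding collide_def by blast
    then have cm: "c = c'" "m = 0" using * c by blast+
    have "u = u'"
    proof (cases c)
      case (Inl v)
      then show ?thesis using z zz cm by (auto simp: ground_def)
    next
      case (Inr e)
      then show ?thesis using * c cm m by (simp add: cell_point_inj)
    qed
    then show "z = z'" using zz cm by simp
  qed
qed

text \<open>A bound is needed so that only finitely many translates can collide. It is an open condition and
  holds for the configurations whose nodes lie in the unit cube.\<close>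

definition in_box :: "('v \<times> 3 \<Rightarrow> real) \<Rightarrow> bool" where
  "in_box x \<longleftrightarrow> (\<forall>v\<in>verts Q. \<forall>i. \<bar>x (v, i)\<bar> < 2)"

lemma finite_int_vec_bounded: "finite {m :: int^3. \<forall>i. \<bar>m $ i\<bar> \<le> K}"
proof (rule finite_subset)
  show "{m :: int^3. \<forall>i. \<bar>m $ i\<bar> \<le> K} \<subseteq> vec_lambda ` (PiE UNIV (\<lambda>_. {- K..K}))"
  proof
    fix m :: "int^3" assume "m \<in> {m. \<forall>i. \<bar>m $ i\<bar> \<le> K}"
    then have "vec_nth m \<in> PiE UNIV (\<lambda>_. {- K..K})" by (auto simp: abs_le_iff minus_le_iff)
    moreover have "m = vec_lambda (vec_nth m)" by simp
    ultimately show "m \<in> vec_lambda ` (PiE UNIV (\<lambda>_. {- K..K}))" by blast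
  qed
qed (intro finite_imageI finite_PiE, auto)

lemma collide_finite:
  "\<exists>M. finite M \<and> 0 \<in> M \<and> (\<forall>x. in_box x \<longrightarrow> (\<forall>c\<in>cells. \<forall>c'\<in>cells. \<forall>m. collide x c c' m \<longrightarrow> m \<in> M))"
proof -
  define R where "R = (\<Sum>e\<in>arcs Q. \<Sum>i\<in>UNIV. \<bar>h e $ i\<bar>)"
  have R0: "0 \<le> R" unfolding R_def by (intro sum_nonneg) auto
  \<comment> \<open>No label has an entry larger than \<open>R\<close>, so the cells lie in a box that depends only on \<open>h\<close>.\<close>
  have R: "\<bar>h e $ i\<bar> \<le> R" if "e \<in> arcs Q" for e i
  proof -
    have "\<bar>h e $ i\<bar> \<le> (\<Sum>i\<in>UNIV. \<bar>h e $ i\<bar>)" by (rule member_le_sum) auto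
    also have "\<dots> \<le> R" unfolding R_def using that by (intro member_le_sum) (auto intro: sum_nonneg)
    finally show ?thesis .
  qed
  have pos: "\<bar>pos x w $ i\<bar> \<le> 2 + R" if "in_box x" "c \<in> cells" "w \<in> {src c, tgt c}" for x w c i
  proof -
    have "fst w \<in> verts Q" using that ends_in_verts by auto
    then have "\<bar>x (fst w, i)\<bar> < 2" using that(1) by (simp add: in_box_def)
    moreover have "\<bar>snd w $ i\<bar> \<le> R" using that(2,3) R R0 by (cases c) auto
    then have "\<bar>real_of_int (snd w $ i)\<bar> \<le> R" by linarith
    ultimately show ?thesis by (simp add: pos_def pt_def int_vec_def)
  qed
  have bound: "\<bar>cell_point x c u $ i\<bar> \<le> 2 + R" if "in_box x" "c \<in> cells" "u \<in> {0<..<1}" for x c u i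
  proof -
    have "\<bar>cell_point x c u $ i\<bar> \<le> (1 - u) * \<bar>pos x (src c) $ i\<bar> + u * \<bar>pos x (tgt c) $ i\<bar>"
      using that(3) abs_triangle_ineq[of "(1 - u) * pos x (src c) $ i" "u * pos x (tgt c) $ i"]
      by (simp add: cell_point_def abs_mult)
    also have "\<dots> \<le> (1 - u) * (2 + R) + u * (2 + R)"
      using that by (intro add_mono mult_left_mono pos[OF that(1,2)]) auto
    finally show ?thesis by (simp add: algebra_simps)
  qed
  have "\<bar>m $ i\<bar> \<le> 4 + 2 * R" if "in_box x" "c \<in> cells" "c' \<in> cells" "collide x c c' m" for x c c' m i
  proof -
    from that(4) obtain u u' where u: "u \<in> {0<..<1}" "u' \<in> {0<..<1}" "cell_point x c u = cell_point x c' u' + int_vec m"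
      unfolding collide_def by blast
    then have "cell_point x c u $ i = cell_point x c' u' $ i + real_of_int (m $ i)" by (simp add: int_vec_def)
    then have "\<bar>real_of_int (m $ i)\<bar> \<le> (2 + R) + (2 + R)"
      using bound[OF that(1,2) u(1), of i] bound[OF that(1,3) u(2), of i] by linarith
    then show ?thesis by linarith
  qed
  then show ?thesis
    using R0 by (intro exI[of _ "{m. \<forall>i. \<bar>m $ i\<bar> \<le> 4 + 2 * R}"] conjI finite_int_vec_bounded) auto
qed

lemma polyfun_pos: "fst w \<in> verts Q \<Longrightarrow> (\<lambda>x. pos x w $ i) \<in> polyfun (verts Q \<times> UNIV)"
  unfolding pos_def pt_def int_vec_def
  by (simp, intro polyfun.add polyfun.var polyfun.const) auto

lemma polyfun_sign_test:
  assumes "s \<in> sign_tests" "c \<in> cells" "c' \<in> cells"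
  shows "(\<lambda>x. s (direction x c) (offset x c c' m) (direction x c')) \<in> polyfun (verts Q \<times> UNIV)"
proof -
  have d: "(\<lambda>x. direction x c $ i) \<in> polyfun (verts Q \<times> UNIV)" if "c \<in> cells" for c i
    unfolding direction_def using that by (simp, intro polyfun_diff polyfun_pos ends_in_verts)
  have o: "(\<lambda>x. offset x c c' m $ i) \<in> polyfun (verts Q \<times> UNIV)" for i
    unfolding offset_def int_vec_def using assms
    by (simp, intro polyfun_diff polyfun.add polyfun.const polyfun_pos ends_in_verts)
  note p = d[OF assms(2)] d[OF assms(3)] o
  have m: "(\<lambda>x. minor (direction x c) (direction x c') i j) \<in> polyfun (verts Q \<times> UNIV)"
    "(\<lambda>x. minor (offset x c c' m) (direction x c') i j) \<in> polyfun (verts Q \<times> UNIV)"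
    "(\<lambda>x. minor (offset x c c' m) (direction x c) i j) \<in> polyfun (verts Q \<times> UNIV)" for i j
    unfolding minor_def by (intro polyfun_diff polyfun.mult p)+
  have "(\<lambda>x. det_test i j k (direction x c) (offset x c c' m) (direction x c')) \<in> polyfun (verts Q \<times> UNIV)" for i j k
    unfolding det_test_def by (intro polyfun_diff polyfun.mult p m)
  then show ?thesis
    using assms(1) p m unfolding sign_tests_def
    by (elim UN_E insertE emptyE) (simp_all add: polyfun_diff polyfun.add)
qed

definition shift :: "'v \<times> (int^3) \<Rightarrow> int^3 \<Rightarrow> 'v \<times> (int^3)" where
  "shift w m = (fst w, snd w + m)"

lemma pos_shift: "pos x (shift w m) = pos x w + int_vec m"
  by (simp add: pos_def shift_def int_vec_add)

lemma collide_crosses: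
  "collide x c c' m \<longleftrightarrow> crosses (pos x (src c)) (pos x (tgt c)) (pos x (shift (src c') m)) (pos x (shift (tgt c') m))"
proof -
  have "cell_point x c' u' + int_vec m = (1 - u') *\<^sub>R pos x (shift (src c') m) + u' *\<^sub>R pos x (shift (tgt c') m)" for u'
    by (simp add: cell_point_def pos_shift algebra_simps)
  then show ?thesis unfolding collide_def crosses_def by (simp add: cell_point_def)
qed

lemma ground_point_eq_node:
  assumes "ground_point c u = node v"
  shows "\<exists>w\<in>{src c, tgt c}. fst w = v \<and> cell_point x c u = pos x w"
proof (cases c)
  case (Inl w)
  then show ?thesis using assms by (auto simp: ground_point_def cell_point_node pos_def split: if_splits)
next
  case (Inr e)
  then show ?thesis using assms by (auto simp: ground_point_def cell_point_def split: if_splits)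
qed

lemma ground_point_eq_inner: "ground_point c u = (Inr e, r) \<Longrightarrow> c = Inr e \<and> u = r"
  by (auto simp: ground_point_def split: if_splits sum.splits)

lemma continuous_pos_line: "continuous_on S (\<lambda>t. pos (line x y t) w)"
  by (rule continuous_pos[OF continuous_on_line])

lemma tendsto_pos_line: "((\<lambda>t. pos (line x y t) w) \<longlongrightarrow> pos x w) (at_right 0)"
proof -
  have "isCont (\<lambda>t. pos (line x y t) w) 0"
    using continuous_pos_line[of UNIV] by (simp add: continuous_on_eq_continuous_at)
  then have "((\<lambda>t. pos (line x y t) w) \<longlongrightarrow> pos x w) (at 0)" by (simp add: isCont_def)
  then show ?thesis by (simp add: filterlim_at_split)
qed

text \<open>A cell that is a vertex gives a degenerate segment for every \<open>t\<close>; such a segment at the end point of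
  another one lies in the interior of the other one only if that one is degenerate too.\<close>

lemma eventually_not_crosses_shared_end:
  assumes "\<not> crosses (pos x a) (pos x b) (pos x a) (pos x d)"
    and b: "b = a \<or> pos x b \<noteq> pos x a" and d: "d = a \<or> pos x d \<noteq> pos x a"
  shows "\<forall>\<^sub>F t in at_right 0. \<not> crosses (pos (line x y t) a) (pos (line x y t) b) (pos (line x y t) a) (pos (line x y t) d)"
proof -
  have degenerate: "\<forall>\<^sub>F t in at_right 0. \<not> crosses (pos (line x y t) a) (pos (line x y t) a) (pos (line x y t) a) (pos (line x y t) d)"
    if "pos x d \<noteq> pos x a" for d
  proof -
    have "\<forall>\<^sub>F t in at_right 0. pos (line x y t) d - pos (line x y t) a \<noteq> 0"
      using that by (intro tendsto_imp_eventually_ne[OF tendsto_diff[OF tendsto_pos_line tendsto_pos_line]]) simp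
    moreover have "\<not> crosses p p p q" if "q - p \<noteq> 0" for p q :: "real^3"
    proof
      assume "crosses p p p q"
      then obtain u u' where "u' \<in> {0<..<1::real}" "(1 - u) *\<^sub>R p + u *\<^sub>R p = (1 - u') *\<^sub>R p + u' *\<^sub>R q"
        unfolding crosses_def by blast
      then have "u' *\<^sub>R (q - p) = 0" "u' \<noteq> 0" by (simp_all add: algebra_simps)
      then show False using that by simp
    qed
    ultimately show ?thesis by (auto elim: eventually_mono)
  qed
  have half: "crosses p p p p" for p :: "real^3"
    unfolding crosses_def by (intro bexI[of _ "1/2"]) auto
  consider "b = a" "d = a" | "b = a" "pos x d \<noteq> pos x a" | "pos x b \<noteq> pos x a" "d = a"
    | "pos x b \<noteq> pos x a" "pos x d \<noteq> pos x a" using b d by blast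
  then show ?thesis
  proof cases
    case 1
    then show ?thesis using assms(1) half by simp
  next
    case 2
    then show ?thesis using degenerate by simp
  next
    case 3
    have "crosses p q p p \<longleftrightarrow> crosses p p p q" for p q :: "real^3" by (rule crosses_sym)
    then show ?thesis using 3 degenerate[of b] by simp
  next
    case 4
    then show ?thesis
      using assms(1) by (intro eventually_not_crosses_shared[OF tendsto_pos_line tendsto_pos_line tendsto_pos_line])
  qed
qed

lemma eventually_not_crosses_common_end:
  assumes not: "\<not> crosses (pos x a) (pos x b) (pos x c) (pos x d)"
    and b: "b = a \<or> pos x b \<noteq> pos x a" and d: "d = c \<or> pos x d \<noteq> pos x c"
    and common: "{a, b} \<inter> {c, d} \<noteq> {}"
  shows "\<forall>\<^sub>F t in at_right 0. \<not> crosses (pos (line x y t) a) (pos (line x y t) b) (pos (line x y t) c) (pos (line x y t) d)"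
proof -
  have b': "a = b \<or> pos x a \<noteq> pos x b" and d': "c = d \<or> pos x c \<noteq> pos x d" using b d by auto
  consider "c = a" | "d = a" | "c = b" | "d = b" using common by blast
  then show ?thesis
  proof cases
    case 1
    then show ?thesis using eventually_not_crosses_shared_end[OF _ b, of d] not d by simp
  next
    case 2
    then have "\<forall>\<^sub>F t in at_right 0. \<not> crosses (pos (line x y t) a) (pos (line x y t) b) (pos (line x y t) a) (pos (line x y t) c)"
      using eventually_not_crosses_shared_end[OF _ b, of c] not d' by (simp add: crosses_swap_right)
    then show ?thesis using 2 by (simp add: crosses_swap_right)
  next
    case 3
    then have "\<forall>\<^sub>F t in at_right 0. \<not> crosses (pos (line x y t) b) (pos (line x y t) a) (pos (line x y t) b) (pos (line x y t) d)"
      using eventually_not_crosses_shared_end[OF _ b', of d] not d by (simp add: crosses_swap_left)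
    then show ?thesis using 3 by (simp add: crosses_swap_left)
  next
    case 4
    then have "\<forall>\<^sub>F t in at_right 0. \<not> crosses (pos (line x y t) b) (pos (line x y t) a) (pos (line x y t) b) (pos (line x y t) c)"
      using eventually_not_crosses_shared_end[OF _ b', of c] not d' by (simp add: crosses_swap_left crosses_swap_right)
    then show ?thesis using 4 by (simp add: crosses_swap_left crosses_swap_right)
  qed
qed

text \<open>Either the two lifts have a lifted vertex in common, which then remains common for all \<open>t\<close>, or their
  closures are disjoint at \<open>t = 0\<close>: points of the closures that coincide represent the same abstract point,
  which cannot lie inside an edge, since the two lifts would be equal, and cannot be a vertex, since the
  lifts would share it.\<close>

lemma eventually_not_collide:
  assumes embedded: "embedded x" and c: "c \<in> cells" "c' \<in> cells" "c \<noteq> c' \<or> m \<noteq> 0"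
  shows "\<forall>\<^sub>F t in at_right 0. \<not> collide (line x y t) c c' m"
proof (cases "{src c, tgt c} \<inter> {shift (src c') m, shift (tgt c') m} = {}")
  case False
  have not: "\<not> crosses (pos x (src c)) (pos x (tgt c)) (pos x (shift (src c') m)) (pos x (shift (tgt c') m))"
    using embedded c unfolding embedded_iff collide_crosses by blast
  have deg: "tgt c = src c \<or> pos x (tgt c) \<noteq> pos x (src c)" if "c \<in> cells" for c
  proof (cases c)
    case (Inr e)
    then show ?thesis using that embedded_edge_ends[OF embedded, of e] by auto
  qed simp
  have "shift (tgt c') m = shift (src c') m \<or> pos x (shift (tgt c') m) \<noteq> pos x (shift (src c') m)"
    using deg[OF c(2)] by (auto simp: pos_shift)
  then show ?thesis
    unfolding collide_crosses by (rule eventually_not_crosses_common_end[OF not deg[OF c(1)] _ False])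
next
  case disjoint: True
  show ?thesis
    unfolding collide_crosses
  proof (intro eventually_not_crosses_disjoint continuous_pos_line notI)
    fix u u' :: real assume u: "u \<in> {0..1}" "u' \<in> {0..1}"
      and eq: "(1 - u) *\<^sub>R pos (line x y 0) (src c) + u *\<^sub>R pos (line x y 0) (tgt c) =
        (1 - u') *\<^sub>R pos (line x y 0) (shift (src c') m) + u' *\<^sub>R pos (line x y 0) (shift (tgt c') m)"
    then have cell_point: "cell_point x c u = cell_point x c' u' + int_vec m"
      by (simp add: cell_point_def pos_shift algebra_simps)
    then have g: "ground_point c u = ground_point c' u'" using u c by (intro embedded_ground_point_eq[OF embedded]) auto
    have "ground_point c u \<in> ground" using u c by (intro ground_point_in_ground)
    then show False
    proof (cases rule: ground_cases)
      case (1 v)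
      obtain w where w: "w \<in> {src c, tgt c}" "fst w = v" "cell_point x c u = pos x w"
        using ground_point_eq_node[OF 1(1)] by blast
      have "ground_point c' u' = node v" using g 1(1) by simp
      from ground_point_eq_node[OF this]
      obtain w' where w': "w' \<in> {src c', tgt c'}" "fst w' = v" "cell_point x c' u' = pos x w'"
        by blast
      have "int_vec (snd w) = int_vec (snd w' + m)"
        using cell_point w w' by (simp add: pos_def int_vec_add)
      then have "w = shift w' m" using w w' by (simp add: shift_def prod_eq_iff)
      then show False using w(1) w'(1) disjoint by auto
    next
      case (2 e r)
      then have "c = Inr e \<and> u = r" "c' = Inr e \<and> u' = r" using ground_point_eq_inner g by metis+
      then show False using c(3) cell_point int_vec_eq_iff[of m 0] by (simp del: int_vec_eq_iff)
    qed
  qed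
qed

lemma eventually_embedded:
  assumes embedded: "embedded x" and box: "in_box x"
  shows "\<forall>\<^sub>F t in at_right 0. embedded (line x y t) \<and> in_box (line x y t)"
proof -
  obtain M where M: "finite M" "0 \<in> M"
    "\<And>x c c' m. in_box x \<Longrightarrow> c \<in> cells \<Longrightarrow> c' \<in> cells \<Longrightarrow> collide x c c' m \<Longrightarrow> m \<in> M"
    using collide_finite by blast
  have "((\<lambda>t. line x y t z) \<longlongrightarrow> x z) (at_right 0)" for z
    unfolding line_def by (rule tendsto_eq_intros refl | simp)+
  then have "\<forall>\<^sub>F t in at_right 0. \<bar>line x y t (v, i)\<bar> < 2" if "v \<in> verts Q" for v i
    using box that by (intro order_tendstoD(2)[OF tendsto_rabs]) (auto simp: in_box_def)
  then have "\<forall>\<^sub>F t in at_right 0. in_box (line x y t)"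
    unfolding in_box_def by (intro eventually_ball_finite eventually_all_finite finite_verts ballI)
  moreover have "\<forall>\<^sub>F t in at_right 0. \<forall>e\<in>arcs Q. direction (line x y t) (Inr e) \<noteq> 0"
  proof (intro eventually_ball_finite finite_arcs ballI)
    fix e assume "e \<in> arcs Q"
    then have "pos x (tgt (Inr e)) - pos x (src (Inr e)) \<noteq> 0" using embedded_edge_ends[OF embedded] by force
    then show "\<forall>\<^sub>F t in at_right 0. direction (line x y t) (Inr e) \<noteq> 0"
      unfolding direction_def
      by (rule tendsto_imp_eventually_ne[OF tendsto_diff[OF tendsto_pos_line tendsto_pos_line]])
  qed
  moreover have "\<forall>\<^sub>F t in at_right 0. \<forall>c\<in>cells. \<forall>c'\<in>cells. \<forall>m\<in>M.
      c \<noteq> c' \<or> m \<noteq> 0 \<longrightarrow> \<not> collide (line x y t) c c' m"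
  proof (intro eventually_ball_finite finite_cells M(1) ballI)
    fix c c' m assume "c \<in> cells" "c' \<in> cells"
    then show "\<forall>\<^sub>F t in at_right 0. c \<noteq> c' \<or> m \<noteq> 0 \<longrightarrow> \<not> collide (line x y t) c c' m"
      using eventually_not_collide[OF embedded, of c c' m y] by (cases "c \<noteq> c' \<or> m \<noteq> 0") auto
  qed
  ultimately show ?thesis
  proof eventually_elim
    case (elim t)
    then show ?case unfolding embedded_iff using M(3)[OF elim(1)] by blast
  qed
qed

section \<open>Finitely many linear isotopy classes\<close>

text \<open>The signs of the polynomials in \<open>F\<close> decide whether a configuration in the box is embedded and whether
  it is in the box. They are constant on the path components of \<open>g \<noteq> 0\<close>, where \<open>g\<close> is the product of the
  polynomials in \<open>F\<close> that are not identically zero.\<close>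

lemma finitely_many_embedded_components:
  "\<exists>S. finite S \<and> (\<forall>x. embedded x \<longrightarrow> in_box x \<longrightarrow> (\<exists>s\<in>S. path_component {x. embedded x} x s))"
proof -
  define V where "V = verts Q \<times> (UNIV :: 3 set)"
  have finV: "finite V" by (simp add: V_def)
  obtain M where M: "finite M" "0 \<in> M"
    "\<And>x c c' m. in_box x \<Longrightarrow> c \<in> cells \<Longrightarrow> c' \<in> cells \<Longrightarrow> collide x c c' m \<Longrightarrow> m \<in> M"
    using collide_finite by blast
  define F where "F = (\<lambda>(s, c, c', m) x. s (direction x c) (offset x c c' m) (direction x c')) ` (sign_tests \<times> cells \<times> cells \<times> M)
     \<union> (\<lambda>z x. x z - 2) ` V \<union> (\<lambda>z x. x z + 2) ` V"
  have finF: "finite F"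
    unfolding F_def using finite_sign_tests finite_cells M(1) finV by auto
  have polyF: "f \<in> polyfun V" if "f \<in> F" for f
    using that unfolding F_def V_def
    by (auto intro: polyfun_sign_test polyfun_diff[OF polyfun.var polyfun.const] polyfun.add[OF polyfun.var polyfun.const])
  define F' where "F' = {f\<in>F. \<exists>x. f x \<noteq> 0}"
  define g where "g x = (\<Prod>f\<in>F'. f x)" for x
  have finF': "finite F'" using finF by (simp add: F'_def)
  have g: "g \<in> polyfun V" unfolding g_def[abs_def] by (intro polyfun_prod polyF) (simp add: F'_def)
  have g_nz: "\<exists>x. g x \<noteq> 0" unfolding g_def
    by (rule polyfun_prod_nonzero[where I = V]) (use finF' polyF in \<open>auto simp: F'_def\<close>)
  have same_sign: "sgn (f y) = sgn (f z)" if "path_component {x. g x \<noteq> 0} y z" "f \<in> F" for f y z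
  proof (cases "f \<in> F'")
    case True
    show ?thesis
    proof (rule path_component_sgn[OF that(1)])
      show "continuous_on {x. g x \<noteq> 0} f" by (rule polyfun_continuous[OF polyF[OF that(2)]])
      show "f w \<noteq> 0" if "w \<in> {x. g x \<noteq> 0}" for w
        using that True finF' by (auto simp: g_def)
    qed
  next
    case False
    then show ?thesis using that(2) by (simp add: F'_def)
  qed
  have preserve: "embedded z" if yz: "path_component {x. g x \<noteq> 0} y z" and y: "embedded y" "in_box y" for y z
  proof -
    have test: "sgn (s (direction y c) (offset y c c' m) (direction y c')) = sgn (s (direction z c) (offset z c c' m) (direction z c'))"
      if "s \<in> sign_tests" "c \<in> cells" "c' \<in> cells" "m \<in> M" for s c c' m
      by (rule same_sign[OF yz]) (use that in \<open>force simp: F_def\<close>)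
    have box: "in_box z" unfolding in_box_def
    proof (intro ballI allI)
      fix v i assume "v \<in> verts Q"
      then have "(v, i) \<in> V" by (simp add: V_def)
      then have "(\<lambda>x. x (v, i) - 2) \<in> F" "(\<lambda>x. x (v, i) + 2) \<in> F" unfolding F_def by blast+
      then have "sgn (y (v, i) - 2) = sgn (z (v, i) - 2)" "sgn (y (v, i) + 2) = sgn (z (v, i) + 2)"
        using same_sign[OF yz] by blast+
      moreover have "\<bar>y (v, i)\<bar> < 2" using y(2) \<open>v \<in> verts Q\<close> by (simp add: in_box_def)
      ultimately show "\<bar>z (v, i)\<bar> < 2" by (auto simp: sgn_if split: if_splits)
    qed
    have "direction z (Inr e) \<noteq> 0" if e: "e \<in> arcs Q" for e
    proof -
      have "direction y (Inr e) \<noteq> 0" using y(1) e unfolding embedded_iff by blast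
      then obtain i where i: "direction y (Inr e) $ i \<noteq> 0" by (auto simp: vec_eq_iff)
      have "(\<lambda>A B C. A $ i) \<in> sign_tests" by (auto simp: sign_tests_def)
      from test[OF this, of "Inr e" "Inr e" 0] e M(2)
      have "sgn (direction y (Inr e) $ i) = sgn (direction z (Inr e) $ i)" by simp
      then show ?thesis using i sgn_eqD(3) by (metis zero_index)
    qed
    moreover have "\<not> collide z c c' m" if c: "c \<in> cells" "c' \<in> cells" "c \<noteq> c' \<or> m \<noteq> 0" for c c' m
    proof
      assume coll: "collide z c c' m"
      then have m: "m \<in> M" using M(3)[OF box c(1,2)] by blast
      have "collide y c c' m"
        using coll unfolding collide_meets
        by (rule meets_sign_determined[rotated]) (rule test[OF _ c(1,2) m, symmetric])
      then show False using y(1) c unfolding embedded_iff by blast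
    qed
    ultimately show ?thesis unfolding embedded_iff by blast
  qed
  have component: "path_component {x. embedded x} y z"
    if yz: "path_component {x. g x \<noteq> 0} y z" and y: "embedded y" "in_box y" for y z
  proof -
    have "path_component_set {x. g x \<noteq> 0} y \<subseteq> {x. embedded x}" using preserve[OF _ y] by auto
    moreover have "path_component (path_component_set {x. g x \<noteq> 0} y) y z"
      using path_connected_path_component[of "{x. g x \<noteq> 0}" y] yz path_component_refl[OF path_component_mem(1)[OF yz]]
      by (simp add: path_connected_component)
    ultimately show ?thesis using path_component_of_subset by blast
  qed
  obtain S where S: "finite S" "\<And>x. g x \<noteq> 0 \<Longrightarrow> \<exists>s\<in>S. path_component {x. g x \<noteq> 0} x s"
    using finitely_many_components_polyfun_nonzero[OF finV g] by blast
  have "\<exists>s\<in>S. path_component {x. embedded x} x s" if x: "embedded x" "in_box x" for x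
  proof -
    obtain y where y: "g y \<noteq> 0" using g_nz by blast
    obtain b where b: "b > 0" "\<And>t. 0 < t \<Longrightarrow> t < b \<Longrightarrow> embedded (line x y t) \<and> in_box (line x y t)"
      using eventually_embedded[OF x, of y] unfolding eventually_at_right_field by auto
    have "finite {t. g (line x y t) = 0}" using polyfun_line_zeros[OF g] y by blast
    then have "infinite ({0<..<b} - {t. g (line x y t) = 0})" using b(1) by (simp add: infinite_Ioo)
    then obtain t where "t \<in> {0<..<b} - {t. g (line x y t) = 0}"
      using infinite_imp_nonempty by blast
    then have t: "0 < t" "t < b" "g (line x y t) \<noteq> 0" by auto
    have "path_component {x. embedded x} x (line x y t)"
    proof (rule path_component_line)
      fix r :: real assume r: "r \<in> {0..1}"
      have "line x (line x y t) r = line x y (r * t)" by (auto simp: line_def)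
      moreover have "embedded (line x y (r * t))"
      proof (cases "r = 0")
        case False
        then have "0 < r * t" using r t by simp
        moreover have "r * t \<le> 1 * t" using r t by (intro mult_right_mono) auto
        then have "r * t < b" using t(2) by linarith
        ultimately show ?thesis using b(2) by blast
      qed (use x in simp)
      ultimately show "line x (line x y t) r \<in> {x. embedded x}" by simp
    qed
    moreover obtain s where "s \<in> S" "path_component {x. g x \<noteq> 0} (line x y t) s"
      using S(2)[OF t(3)] by blast
    moreover have "embedded (line x y t)" "in_box (line x y t)" using b(2) t by blast+
    ultimately show ?thesis using component path_component_trans by meson
  qed
  then show ?thesis using S(1) by blast
qed

end

theorem theorem6p4:
  fixes Q :: "('v, 'e) pre_digraph"
    and h :: "'e \<Rightarrow> int^3"
  assumes "fin_digraph Q"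
  shows "finite ({K. has_labelled_quotient_graph K Q h} // linear_isotopy)"
proof -
  interpret labelled_graph Q h using assms by (simp add: labelled_graph_def)
  obtain S where S: "finite S" "\<And>x. embedded x \<Longrightarrow> in_box x \<Longrightarrow> \<exists>s\<in>S. path_component {x. embedded x} x s"
    using finitely_many_embedded_components by blast
  define cls where "cls K = linear_isotopy `` {K}" for K
  \<comment> \<open>Paths can be reversed, so transitivity of linear isotopy gives both inclusions.\<close>
  have cls_eq: "cls (knot x) = cls (knot y)" if xy: "path_component {x. embedded x} x y" for x y
  proof -
    have "cls (knot x) \<subseteq> cls (knot y)" if "path_component {x. embedded x} x y" for x y
      using linearly_isotopic_trans[OF embedded_path_isotopic[OF path_component_sym[OF that]]]
      by (auto simp: cls_def linear_isotopy_def)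
    then show ?thesis using xy path_component_sym by blast
  qed
  have "{K. has_labelled_quotient_graph K Q h} // linear_isotopy \<subseteq> (\<lambda>s. cls (knot s)) ` S"
  proof
    fix C assume "C \<in> {K. has_labelled_quotient_graph K Q h} // linear_isotopy"
    then obtain K where K: "has_labelled_quotient_graph K Q h" "C = cls K"
      by (auto simp: quotient_def cls_def)
    then obtain x where x: "embedded x" "K = knot x" "\<forall>v\<in>verts Q. \<forall>i. 0 \<le> x (v, i) \<and> x (v, i) < 1"
      using labelled_knot_embedded by blast
    have "in_box x" unfolding in_box_def
    proof (intro ballI allI)
      fix v i assume "v \<in> verts Q"
      then have "0 \<le> x (v, i)" "x (v, i) < 1" using x(3) by blast+
      then show "\<bar>x (v, i)\<bar> < 2" by simp
    qed
    then obtain s where "s \<in> S" "path_component {x. embedded x} x s" using S(2) x(1) by blast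
    then show "C \<in> (\<lambda>s. cls (knot s)) ` S" using K x cls_eq by auto
  qed
  then show ?thesis using S(1) finite_subset by blast
qed

end
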